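(* Let $H$ be a complex Hilbert space and let $T\in\mathcal{AN}(H)$ be self-adjoint with polar decomposition $T=V|T|$. Then there exist a real number $\alpha\ge 0$ and self-adjoint operators $K\in\mathcal K(H)$ and $F\in\mathcal F(H)$ such that (1) $T=K-F+\alpha V$, with $KF=0$ and $F^2\le\alpha^2 I$; (2) if $T$ is not a compact operator, then $V\in\mathcal{AN}(H)$; (3) $K^2+2\alpha\,\mathrm{Re}(VK)\ge 0$.
   Context: $\mathcal B(H)$, $\mathcal K(H)$, $\mathcal F(H)$ denote the bounded, compact, and finite rank linear operators on $H$. An operator is positive ($\geq 0$) if it is self-adjoint and $\langle Tx,x\rangle\ge 0$ for all $x$; for self-adjoint $S,T$, $S\le T$ means $T-S\ge 0$. $|T|=(T^*T)^{1/2}$; the polar decomposition $T=V|T|$ is the one with $V$ the unique partial isometry satisfying $N(V)=N(T)$ (null spaces). $\mathrm{Re}(A)=\frac{A+A^*}{2}$. An operator $T\in\mathcal B(H)$ is norm attaining if there is a unit vector $x$ with $\|Tx\|=\|T\|$; it is absolutely norm attaining, written $T\in\mathcal{AN}(H)$, if the restriction $T|_M:M\to H$ is norm attaining for every nonzero closed subspace $M$ of $H$. *)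

theory Defs
  imports "HOL-Analysis.Analysis"
begin

section \<open>Complex Hilbert spaces\<close>

text \<open>
  A complex inner product space, with an inner product that is linear in the first argument. It is
  placed on top of \<open>real_inner\<close>: the underlying real structure is the restriction of scalars,
  and the real inner product is the real part of the complex one, so that the inherited norm and
  topology are those induced by the complex inner product (see \<open>cinner_self\<close> below).
\<close>

class complex_inner = real_inner +
  fixes scaleC :: "complex \<Rightarrow> 'a \<Rightarrow> 'a"  (infixr "*\<^sub>C" 75)
    and cinner :: "'a \<Rightarrow> 'a \<Rightarrow> complex"
  assumes scaleC_add_right: "c *\<^sub>C (x + y) = c *\<^sub>C x + c *\<^sub>C y"
    and scaleC_add_left: "(c + d) *\<^sub>C x = c *\<^sub>C x + d *\<^sub>C x"
    and scaleC_scaleC: "c *\<^sub>C d *\<^sub>C x = (c * d) *\<^sub>C x"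
    and scaleR_scaleC: "r *\<^sub>R x = complex_of_real r *\<^sub>C x"
    and cinner_commute: "cinner x y = cnj (cinner y x)"
    and cinner_add_left: "cinner (x + y) z = cinner x z + cinner y z"
    and cinner_scaleC_left: "cinner (c *\<^sub>C x) y = c * cinner x y"
    and inner_eq_Re_cinner: "inner x y = Re (cinner x y)"

class chilbert_space = complex_inner + complete_space

lemma scaleC_one: "1 *\<^sub>C x = (x :: 'a :: complex_inner)"
  using scaleR_scaleC[of 1 x] by simp

lemma cinner_self: "cinner x x = complex_of_real ((norm x)\<^sup>2)"
  for x :: "'a :: complex_inner"
proof (rule complex_eqI)
  show "Re (cinner x x) = Re (complex_of_real ((norm x)\<^sup>2))"
    by (simp add: power2_norm_eq_inner inner_eq_Re_cinner)
  have "Im (cinner x x) = - Im (cinner x x)"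
    using arg_cong[OF cinner_commute[of x x], of Im] by simp
  then show "Im (cinner x x) = Im (complex_of_real ((norm x)\<^sup>2))"
    by simp
qed

global_interpretation cvec: vector_space "scaleC :: complex \<Rightarrow> 'a \<Rightarrow> 'a :: complex_inner"
  by standard (simp_all add: scaleC_add_right scaleC_add_left scaleC_scaleC scaleC_one)

instantiation complex :: chilbert_space
begin

definition scaleC_complex :: "complex \<Rightarrow> complex \<Rightarrow> complex"
  where "scaleC_complex c x = c * x"

definition cinner_complex :: "complex \<Rightarrow> complex \<Rightarrow> complex"
  where "cinner_complex x y = x * cnj y"

instance
  by standard
    (simp_all add: scaleC_complex_def cinner_complex_def algebra_simps scaleR_conv_of_real
      inner_complex_def)

end


section \<open>Classes of operators\<close>

definition bounded_clinear :: "('a :: chilbert_space \<Rightarrow> 'a) \<Rightarrow> bool"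
  where "bounded_clinear T \<longleftrightarrow>
    bounded_linear T \<and> (\<forall>c x. T (c *\<^sub>C x) = c *\<^sub>C T x)"

definition compact_op :: "('a :: chilbert_space \<Rightarrow> 'a) \<Rightarrow> bool"
  where "compact_op T \<longleftrightarrow> bounded_clinear T \<and> compact (closure (T ` cball 0 1))"

definition finite_rank_op :: "('a :: chilbert_space \<Rightarrow> 'a) \<Rightarrow> bool"
  where "finite_rank_op T \<longleftrightarrow>
    bounded_clinear T \<and> (\<exists>B. finite B \<and> range T \<subseteq> cvec.span B)"

text \<open>For bounded \<open>T\<close> the description determines the Hilbert space adjoint uniquely.\<close>

definition cadjoint :: "('a :: chilbert_space \<Rightarrow> 'a) \<Rightarrow> 'a \<Rightarrow> 'a"
  where "cadjoint T = (THE S. \<forall>x y. cinner (T x) y = cinner x (S y))"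

definition selfadjoint_op :: "('a :: chilbert_space \<Rightarrow> 'a) \<Rightarrow> bool"
  where "selfadjoint_op T \<longleftrightarrow> bounded_clinear T \<and> cadjoint T = T"

text \<open>
  For self-adjoint \<open>T\<close> the number \<open>cinner (T x) x\<close> is real, so taking its real part
  loses nothing.
\<close>

definition positive_op :: "('a :: chilbert_space \<Rightarrow> 'a) \<Rightarrow> bool"
  where "positive_op T \<longleftrightarrow> selfadjoint_op T \<and> (\<forall>x. Re (cinner (T x) x) \<ge> 0)"

definition op_le :: "('a :: chilbert_space \<Rightarrow> 'a) \<Rightarrow> ('a \<Rightarrow> 'a) \<Rightarrow> bool"
  where "op_le S T \<longleftrightarrow>
    selfadjoint_op S \<and> selfadjoint_op T \<and> positive_op (\<lambda>x. T x - S x)"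

definition Re_op :: "('a :: chilbert_space \<Rightarrow> 'a) \<Rightarrow> 'a \<Rightarrow> 'a"
  where "Re_op T = (\<lambda>x. (1 / 2) *\<^sub>C (T x + cadjoint T x))"


section \<open>Polar decomposition\<close>

text \<open>The positive square root of a positive operator; it exists and is unique.\<close>

definition sqrt_op :: "('a :: chilbert_space \<Rightarrow> 'a) \<Rightarrow> 'a \<Rightarrow> 'a"
  where "sqrt_op T = (THE S. positive_op S \<and> S \<circ> S = T)"

definition abs_op :: "('a :: chilbert_space \<Rightarrow> 'a) \<Rightarrow> 'a \<Rightarrow> 'a"
  where "abs_op T = sqrt_op (cadjoint T \<circ> T)"

definition null_space :: "('a :: chilbert_space \<Rightarrow> 'a) \<Rightarrow> 'a set"
  where "null_space T = {x. T x = 0}"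

definition partial_isometry :: "('a :: chilbert_space \<Rightarrow> 'a) \<Rightarrow> bool"
  where "partial_isometry V \<longleftrightarrow> bounded_clinear V \<and>
    (\<forall>x. (\<forall>y \<in> null_space V. cinner x y = 0) \<longrightarrow> norm (V x) = norm x)"

definition polar_decomposition :: "('a :: chilbert_space \<Rightarrow> 'a) \<Rightarrow> ('a \<Rightarrow> 'a) \<Rightarrow> bool"
  where "polar_decomposition T V \<longleftrightarrow>
    partial_isometry V \<and> null_space V = null_space T \<and> T = V \<circ> abs_op T"


section \<open>Absolutely norm attaining operators\<close>

text \<open>
  The operator norm of the restriction of \<open>T\<close> to a subspace \<open>M\<close>, by the formula of
  \<open>onorm\<close> (which is the case \<open>M = UNIV\<close>).
\<close>

definition onorm_on :: "'a :: chilbert_space set \<Rightarrow> ('a \<Rightarrow> 'a) \<Rightarrow> real"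
  where "onorm_on M T = (SUP x \<in> M. norm (T x) / norm x)"

definition norm_attaining_on :: "'a :: chilbert_space set \<Rightarrow> ('a \<Rightarrow> 'a) \<Rightarrow> bool"
  where "norm_attaining_on M T \<longleftrightarrow>
    (\<exists>x \<in> M. norm x = 1 \<and> norm (T x) = onorm_on M T)"

definition absolutely_norm_attaining :: "('a :: chilbert_space \<Rightarrow> 'a) \<Rightarrow> bool"
  where "absolutely_norm_attaining T \<longleftrightarrow> bounded_clinear T \<and>
    (\<forall>M. cvec.subspace M \<and> closed M \<and> M \<noteq> {0} \<longrightarrow> norm_attaining_on M T)"

end

theory Submission
  imports Defs
begin

text \<open>
  On a nonzero closed invariant subspace the norm of \<open>T\<close> is attained at some \<open>x\<close>; there \<open>T (T x)\<close> is
  a nonnegative multiple of \<open>x\<close>, so \<open>T\<close> has an eigenvector in the subspace.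
  By Zorn's lemma \<open>T\<close> is diagonal in an orthonormal basis, with eigenvalues
  \<open>\<mu> e\<close>; then \<open>abs_op T\<close> and \<open>V\<close> are diagonal with entries \<open>\<bar>\<mu> e\<bar>\<close> and \<open>sgn (\<mu> e)\<close>. Norm attainment on
  closed spans of orthonormal sequences rules out strictly increasing values of the norm
  along the sequence, so for a suitable \<open>\<alpha>\<close> only finitely many \<open>\<bar>\<mu> e\<bar>\<close> lie below \<open>\<alpha>\<close>, and only finitely
  many above any \<open>a > \<alpha>\<close>. The parts of \<open>sgn (\<mu> e) * (\<bar>\<mu> e\<bar> - \<alpha>)\<close> above and below \<open>\<alpha>\<close> give \<open>K\<close> and \<open>- F\<close>.
\<close>

section \<open>Geometry of complex Hilbert spaces\<close>

text \<open>\<open>T\<close> need not be compact, so eigenvectors are found by a variational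
  argument: norm attainment supplies a maximiser, and the vanishing first variation there replaces
  compactness. Infinite series are avoided throughout. A diagonal operator is described by its
  coefficients against the basis, identities extend from the basis to the whole space because they
  hold on closed subspaces, and \<open>K\<close> is obtained from \<open>T\<close>, \<open>F\<close>
  and \<open>V\<close> by subtraction. The number \<alpha> is the largest level at which the moduli
  of the eigenvalues accumulate or repeat infinitely often, and 0 in finite dimension. Each claim
  then becomes a scalar one: \<open>K\<close> and \<open>F\<close> have disjoint supports; the
  entries of \<open>F\<close> have modulus at most \<alpha>; and \<open>V\<close> cancels the sign
  in \<open>K\<close>, so the entries of \<open>V K\<close> are the positive parts of
  \<open>\<bar>\<mu> e\<bar> - \<alpha>\<close>. If \<open>T\<close> is not compact, then \<alpha> >
  0, so only finitely many basis vectors lie in the null space of \<open>V\<close>; a closed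
  subspace therefore either contains a unit vector on which \<open>V\<close> is isometric or is
  finite dimensional.\<close>

lemma cinner_add_right: "cinner x (y + z) = cinner x y + cinner x (z :: 'a :: complex_inner)"
  by (metis cinner_add_left cinner_commute complex_cnj_add)

lemma cinner_scaleC_right: "cinner x (c *\<^sub>C y) = cnj c * cinner x (y :: 'a :: complex_inner)"
  by (metis cinner_commute cinner_scaleC_left complex_cnj_mult)

lemma cinner_zero_left [simp]: "cinner 0 (y :: 'a :: complex_inner) = 0"
  using cinner_add_left[of 0 0 y] by simp

lemma cinner_zero_right [simp]: "cinner (y :: 'a :: complex_inner) 0 = 0"
  using cinner_add_right[of y 0 0] by simp

lemma cinner_diff_left: "cinner (x - y) z = cinner x z - cinner y (z :: 'a :: complex_inner)"
  using cinner_add_left[of "x - y" y z] by simp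

lemma cinner_diff_right: "cinner x (y - z) = cinner x y - cinner x (z :: 'a :: complex_inner)"
  using cinner_add_right[of x "y - z" z] by simp

lemma cinner_sum_left: "cinner (\<Sum>i\<in>I. f i) y = (\<Sum>i\<in>I. cinner (f i) (y :: 'a :: complex_inner))"
  by (induction I rule: infinite_finite_induct) (auto simp: cinner_add_left)

lemma cinner_self_eq_0_iff: "cinner x x = 0 \<longleftrightarrow> x = (0 :: 'a :: complex_inner)"
  by (simp add: cinner_self)

lemma cinner_eq_0_commute: "cinner x y = 0 \<longleftrightarrow> cinner y x = (0 :: complex)"
  for x y :: "'a :: complex_inner"
  by (metis cinner_commute complex_cnj_zero)

text \<open>The bridge from real to complex: an identity for \<open>inner\<close> tested at
  \<open>y\<close> and at \<open>\<i> *\<^sub>C y\<close> yields the identity for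
  \<open>cinner\<close>.\<close>

lemma cinner_conv_inner: "cinner x y = Complex (inner x y) (inner x (\<i> *\<^sub>C y))"
  for x y :: "'a :: complex_inner"
  by (simp add: inner_eq_Re_cinner cinner_scaleC_right complex_eq_iff)

lemma norm_scaleC [simp]: "norm (c *\<^sub>C x) = cmod c * norm (x :: 'a :: complex_inner)"
proof -
  have "cinner (c *\<^sub>C x) (c *\<^sub>C x) = (c * cnj c) * cinner x x"
    by (simp add: cinner_scaleC_left cinner_scaleC_right mult_ac)
  then have "complex_of_real ((norm (c *\<^sub>C x))\<^sup>2) = complex_of_real ((cmod c * norm x)\<^sup>2)"
    by (simp add: cinner_self power_mult_distrib flip: complex_norm_square)
  then have "(norm (c *\<^sub>C x))\<^sup>2 = (cmod c * norm x)\<^sup>2"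
    by (simp only: of_real_eq_iff)
  then show ?thesis
    by (metis abs_mult abs_norm_cancel power2_eq_iff_nonneg norm_ge_zero zero_le_mult_iff)
qed

lemma cinner_cauchy_schwarz: "cmod (cinner x y) \<le> norm x * norm (y :: 'a :: complex_inner)"
proof (cases "cinner x y = 0")
  case False
  \<comment> \<open>A unimodular phase that rotates \<open>x\<close> until the inner product is real
    and nonnegative, so that the real Cauchy-Schwarz inequality applies.\<close>
  define c where "c = cnj (cinner x y) / cmod (cinner x y)"
  have c: "cmod c = 1" using False by (simp add: c_def norm_divide)
  have "cinner (c *\<^sub>C x) y = complex_of_real (cmod (cinner x y))"
    using False complex_norm_square[of "cinner x y"]
    by (simp add: c_def cinner_scaleC_left field_simps power2_eq_square)
  then have "cmod (cinner x y) = inner (c *\<^sub>C x) y"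
    by (simp add: inner_eq_Re_cinner)
  also have "\<dots> \<le> norm (c *\<^sub>C x) * norm y" by (rule norm_cauchy_schwarz)
  finally show ?thesis by (simp add: c)
qed simp

lemma bounded_linear_cinner_left: "bounded_linear (\<lambda>x. cinner x (y :: 'a :: complex_inner))"
proof (rule bounded_linear_intro)
  show "norm (cinner x y) \<le> norm x * norm y" for x by (rule cinner_cauchy_schwarz)
qed (simp_all add: cinner_add_left scaleR_scaleC cinner_scaleC_left scaleC_complex_def)

lemma bounded_linear_cinner_right: "bounded_linear (\<lambda>y. cinner x (y :: 'a :: complex_inner))"
proof (rule bounded_linear_intro)
  show "norm (cinner x y) \<le> norm y * norm x" for y
    using cinner_cauchy_schwarz[of x y] by (simp add: mult.commute)
qed (simp_all add: cinner_add_right scaleR_scaleC cinner_scaleC_right scaleC_complex_def)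

lemma bounded_linear_scaleC_left: "bounded_linear (\<lambda>c. c *\<^sub>C (x :: 'a :: complex_inner))"
proof (rule bounded_linear_intro)
  show "norm (c *\<^sub>C x) \<le> norm c * norm x" for c by simp
qed (simp_all add: scaleC_add_left scaleR_scaleC scaleC_scaleC scaleC_complex_def)

lemma bounded_linear_scaleC_right: "bounded_linear (\<lambda>x. c *\<^sub>C (x :: 'a :: complex_inner))"
proof (rule bounded_linear_intro)
  show "norm (c *\<^sub>C x) \<le> norm x * cmod c" for x by simp
qed (simp_all add: scaleC_add_right scaleR_scaleC scaleC_scaleC mult.commute)

lemmas continuous_on_cinner_left [continuous_intros] =
  bounded_linear.continuous_on[OF bounded_linear_cinner_left]
lemmas continuous_on_cinner_right [continuous_intros] =
  bounded_linear.continuous_on[OF bounded_linear_cinner_right]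

lemma subspace_scaleR: "cvec.subspace M \<Longrightarrow> x \<in> M \<Longrightarrow> r *\<^sub>R x \<in> M"
  for M :: "'a :: complex_inner set"
  by (simp add: scaleR_scaleC cvec.subspace_scale)

lemma closed_subspace_orthogonal:
  fixes E :: "'a :: complex_inner set"
  shows "cvec.subspace {x. \<forall>e\<in>E. cinner x e = 0}" "closed {x. \<forall>e\<in>E. cinner x e = 0}"
proof -
  show "cvec.subspace {x. \<forall>e\<in>E. cinner x e = 0}"
    by (rule cvec.subspaceI) (auto simp: cinner_add_left cinner_scaleC_left)
  have "closed (\<Inter>e\<in>E. {x. cinner x e = 0})"
    by (intro closed_INT ballI closed_Collect_eq continuous_intros)
  also have "(\<Inter>e\<in>E. {x. cinner x e = 0}) = {x. \<forall>e\<in>E. cinner x e = 0}" by auto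
  finally show "closed {x. \<forall>e\<in>E. cinner x e = 0}" .
qed

lemma closure_span_subspace: "cvec.subspace (closure (cvec.span (S :: 'a :: complex_inner set)))"
proof (rule cvec.subspaceI)
  show "0 \<in> closure (cvec.span S)"
    using closure_subset cvec.span_zero by blast
next
  fix x y assume "x \<in> closure (cvec.span S)" "y \<in> closure (cvec.span S)"
  then obtain u v where uv: "\<And>n. u n \<in> cvec.span S" "u \<longlonglongrightarrow> x" "\<And>n. v n \<in> cvec.span S" "v \<longlonglongrightarrow> y"
    unfolding closure_sequential by auto
  have "(\<lambda>n. u n + v n) \<longlonglongrightarrow> x + y" by (intro tendsto_intros uv)
  moreover have "u n + v n \<in> cvec.span S" for n by (intro cvec.span_add uv)
  ultimately show "x + y \<in> closure (cvec.span S)"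
    unfolding closure_sequential by (intro exI[of _ "\<lambda>n. u n + v n"]) simp
next
  fix c x assume "x \<in> closure (cvec.span S)"
  then obtain u where u: "\<And>n. u n \<in> cvec.span S" "u \<longlonglongrightarrow> x"
    unfolding closure_sequential by auto
  have "(\<lambda>n. c *\<^sub>C u n) \<longlonglongrightarrow> c *\<^sub>C x"
    by (intro bounded_linear.tendsto[OF bounded_linear_scaleC_right] u)
  moreover have "c *\<^sub>C u n \<in> cvec.span S" for n by (intro cvec.span_scale u)
  ultimately show "c *\<^sub>C x \<in> closure (cvec.span S)"
    unfolding closure_sequential by (intro exI[of _ "\<lambda>n. c *\<^sub>C u n"]) simp
qed

lemma linear_term_vanishes:
  fixes r c :: real
  assumes "\<And>t. 0 \<le> 2 * t * r + t\<^sup>2 * c" and "0 \<le> c"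
  shows "r = 0"
proof (rule ccontr)
  assume "r \<noteq> 0"
  \<comment> \<open>The test point is \<open>t = - r / (c + 1)\<close>; the summand 1 covers the
    case \<open>c = 0\<close>, where the quadratic has no minimiser to choose.\<close>
  define u where "u = c + 1"
  have u: "0 < u" using assms(2) by (simp add: u_def)
  have "0 \<le> (2 * (- r / u) * r + (- r / u)\<^sup>2 * c) * u\<^sup>2"
    using assms(1)[of "- r / u"] by (intro mult_nonneg_nonneg) auto
  also have "\<dots> = - 2 * r\<^sup>2 * u + r\<^sup>2 * c"
    using u by (simp add: field_simps power2_eq_square)
  also have "\<dots> = - (r\<^sup>2 * (c + 2))" by (simp add: u_def algebra_simps)
  finally show False using assms(2) \<open>r \<noteq> 0\<close> by (simp add: mult_le_0_iff)
qed

lemma cinner_eq_0_of_inner: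
  fixes M :: "'a :: complex_inner set"
  assumes "cvec.subspace M" "\<And>y. y \<in> M \<Longrightarrow> inner x y = 0" "y \<in> M"
  shows "cinner x y = 0"
  using assms cvec.subspace_scale[OF assms(1,3), of \<i>]
  by (simp add: cinner_conv_inner complex_eq_iff)

text \<open>A minimising sequence for the distance from \<open>x\<close> to \<open>M\<close> is
  Cauchy by the parallelogram law. Its limit is a nearest point, and perturbing it inside
  \<open>M\<close> gives orthogonality.\<close>

lemma orthogonal_projection_exists:
  fixes M :: "'a :: chilbert_space set"
  assumes M: "cvec.subspace M" "closed M"
  obtains p where "p \<in> M" "\<And>y. y \<in> M \<Longrightarrow> cinner (x - p) y = 0"
proof -
  define d where "d = (INF y\<in>M. (norm (x - y))\<^sup>2)"
  have M0: "0 \<in> M" using M(1) cvec.subspace_0 by blast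
  have bdd: "bdd_below ((\<lambda>y. (norm (x - y))\<^sup>2) ` M)" by (rule bdd_belowI2[of _ 0]) simp
  have d_le: "d \<le> (norm (x - y))\<^sup>2" if "y \<in> M" for y
    unfolding d_def by (rule cINF_lower[OF bdd that])
  have "\<exists>y\<in>M. (norm (x - y))\<^sup>2 < d + 1 / real (Suc n)" for n
  proof -
    have "d < d + 1 / real (Suc n)" by simp
    then show ?thesis
      unfolding d_def using M0 by (subst (asm) cINF_less_iff[OF _ bdd]) auto
  qed
  then obtain p where pM: "\<And>n. p n \<in> M" and p: "\<And>n. (norm (x - p n))\<^sup>2 < d + 1 / real (Suc n)"
    by metis
  have par: "(norm (p n - p m))\<^sup>2 \<le> 2 / real (Suc n) + 2 / real (Suc m)" for n m
  proof -
    \<comment> \<open>Parallelogram law. The midpoint lies in \<open>M\<close>, so its squared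
      distance to \<open>x\<close> is at least \<open>d\<close>, and only the two slack terms
      survive.\<close>
    have "(norm (p n - p m))\<^sup>2 + 4 * (norm (x - (1/2) *\<^sub>R (p n + p m)))\<^sup>2
        = 2 * (norm (x - p n))\<^sup>2 + 2 * (norm (x - p m))\<^sup>2"
      by (simp add: power2_norm_eq_inner inner_diff_left inner_diff_right inner_add_left
          inner_add_right inner_commute algebra_simps)
    moreover have "d \<le> (norm (x - (1/2) *\<^sub>R (p n + p m)))\<^sup>2"
      by (intro d_le subspace_scaleR cvec.subspace_add M pM)
    ultimately show ?thesis using p[of n] p[of m] by simp
  qed
  have "Cauchy p"
  proof (rule metric_CauchyI)
    fix e :: real assume "0 < e"
    then obtain N where N: "4 / e\<^sup>2 < real N" using reals_Archimedean2 by blast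
    have "dist (p m) (p n) < e" if "N \<le> m" "N \<le> n" for m n
    proof -
      have "2 / real (Suc m) \<le> 2 / real (Suc N)" "2 / real (Suc n) \<le> 2 / real (Suc N)"
        using that by (simp_all add: frac_le)
      then have "(norm (p m - p n))\<^sup>2 \<le> 4 / real (Suc N)" using par[of m n] by simp
      also have "\<dots> < e\<^sup>2"
        using N \<open>0 < e\<close> by (simp add: field_simps) (smt (verit) zero_less_power)
      finally show ?thesis using \<open>0 < e\<close> by (simp add: dist_norm power2_less_imp_less)
    qed
    then show "\<exists>N. \<forall>m\<ge>N. \<forall>n\<ge>N. dist (p m) (p n) < e" by blast
  qed
  then obtain q where q: "p \<longlonglongrightarrow> q" using Cauchy_convergent convergent_def by blast
  have qM: "q \<in> M" using closed_sequentially[OF M(2)] pM q by blast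
  have "(\<lambda>n. (norm (x - p n))\<^sup>2) \<longlonglongrightarrow> (norm (x - q))\<^sup>2" by (intro tendsto_intros q)
  moreover have "(\<lambda>n. d + 1 / real (Suc n)) \<longlonglongrightarrow> d + 0"
    by (intro tendsto_intros LIMSEQ_Suc[OF lim_1_over_n])
  ultimately have q_le: "(norm (x - q))\<^sup>2 \<le> d"
    using p by (intro LIMSEQ_le[of _ _ "\<lambda>n. d + 1 / real (Suc n)"]) (auto intro: less_imp_le)
  have "inner (x - q) y = 0" if "y \<in> M" for y
  proof -
    have "- inner (x - q) y = 0"
    proof (rule linear_term_vanishes)
      fix t :: real
      have "(norm (x - q))\<^sup>2 \<le> (norm (x - (q + t *\<^sub>R y)))\<^sup>2"
        using q_le d_le[of "q + t *\<^sub>R y"] M(1) qM that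
        by (smt (verit) cvec.subspace_add subspace_scaleR)
      moreover have "(norm (x - (q + t *\<^sub>R y)))\<^sup>2
          = (norm (x - q))\<^sup>2 + (2 * t * - inner (x - q) y + t\<^sup>2 * inner y y)"
        unfolding power2_norm_eq_inner
        by (simp add: inner_diff_left inner_diff_right inner_add_left
            inner_add_right inner_commute power2_eq_square algebra_simps)
      ultimately show "0 \<le> 2 * t * - inner (x - q) y + t\<^sup>2 * inner y y" by linarith
    qed simp
    then show ?thesis by simp
  qed
  then have "cinner (x - q) y = 0" if "y \<in> M" for y
    using cinner_eq_0_of_inner[OF M(1) _ that] by blast
  with qM show ?thesis by (rule that)
qed

text \<open>The residual of the projection to \<open>M\<close> is orthogonal to \<open>E\<close>,
  hence zero. This is the density principle behind every extension from basis vectors to all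
  vectors.\<close>

lemma closed_subspace_eq_UNIV:
  fixes M :: "'a :: chilbert_space set"
  assumes "cvec.subspace M" "closed M" "E \<subseteq> M"
    and "\<And>x. (\<And>e. e \<in> E \<Longrightarrow> cinner x e = 0) \<Longrightarrow> x = 0"
  shows "M = UNIV"
proof -
  have "x \<in> M" for x
  proof -
    obtain p where p: "p \<in> M" "\<And>y. y \<in> M \<Longrightarrow> cinner (x - p) y = 0"
      using orthogonal_projection_exists[OF assms(1,2)] by metis
    have "x - p = 0" using p assms(3,4) by blast
    with p show ?thesis by simp
  qed
  then show ?thesis by blast
qed

section \<open>Bounded operators and adjoints\<close>

lemma bounded_clinear_linear:
  assumes "bounded_clinear T"
  shows "T (x + y) = T x + T y" "T (x - y) = T x - T y" "T 0 = 0" "T (c *\<^sub>C x) = c *\<^sub>C T x"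
    "T (r *\<^sub>R x) = r *\<^sub>R T x"
  using assms unfolding bounded_clinear_def
  by (auto simp: linear_simps)

lemma bounded_clinear_bounded: 
  assumes "bounded_clinear T" obtains B where "0 < B" "\<And>x. norm (T x) \<le> B * norm x"
  using assms bounded_linear.pos_bounded[of T] unfolding bounded_clinear_def
  by (metis mult.commute)

lemma bounded_clinear_compose:
  "bounded_clinear S \<Longrightarrow> bounded_clinear T \<Longrightarrow> bounded_clinear (\<lambda>x. S (T x))"
  unfolding bounded_clinear_def by (auto intro: bounded_linear_compose)

lemma bounded_clinear_add:
  "bounded_clinear S \<Longrightarrow> bounded_clinear T \<Longrightarrow> bounded_clinear (\<lambda>x. S x + T x)"
  unfolding bounded_clinear_def by (auto intro: bounded_linear_add simp: scaleC_add_right)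

lemma bounded_clinear_diff:
  "bounded_clinear S \<Longrightarrow> bounded_clinear T \<Longrightarrow> bounded_clinear (\<lambda>x. S x - T x)"
  unfolding bounded_clinear_def by (auto intro: bounded_linear_sub simp: cvec.scale_right_diff_distrib)

lemma bounded_clinear_scaleC: "bounded_clinear T \<Longrightarrow> bounded_clinear (\<lambda>x. c *\<^sub>C T x)"
  unfolding bounded_clinear_def
  by (auto intro: bounded_linear_compose[OF bounded_linear_scaleC_right] simp: scaleC_scaleC mult.commute)

lemma bounded_clinear_zero: "bounded_clinear (\<lambda>x. 0)"
  unfolding bounded_clinear_def by auto

lemma bounded_clinear_ident: "bounded_clinear (\<lambda>x. x)"
  unfolding bounded_clinear_def by auto

lemma bounded_clinear_sum:
  "(\<And>i. i \<in> I \<Longrightarrow> bounded_clinear (S i)) \<Longrightarrow> bounded_clinear (\<lambda>x. \<Sum>i\<in>I. S i x)"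
  by (induction I rule: infinite_finite_induct) (auto intro: bounded_clinear_zero bounded_clinear_add)

lemma bounded_clinear_rank_one: "bounded_clinear (\<lambda>x. cinner x y *\<^sub>C z)"
  unfolding bounded_clinear_def
  by (auto intro: bounded_linear_compose[OF bounded_linear_scaleC_left bounded_linear_cinner_left]
      simp: cinner_scaleC_left scaleC_scaleC)

text \<open>The Riesz representation argument for the functional
  \<open>\<lambda>x. cinner (T x) y\<close>: unless it vanishes, it is represented by a multiple of
  a vector \<open>w\<close> orthogonal to its kernel \<open>N\<close>.\<close>

lemma adjoint_exists:
  assumes T: "bounded_clinear T"
  shows "\<exists>S. \<forall>x y. cinner (T x) y = cinner x (S y)"
proof -
  have "\<exists>z. \<forall>x. cinner (T x) y = cinner x z" for y
  proof -
    define N where "N = {x. cinner (T x) y = 0}"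
    have N: "cvec.subspace N"
      unfolding N_def
      by (rule cvec.subspaceI)
        (auto simp: bounded_clinear_linear[OF T] cinner_add_left cinner_scaleC_left)
    have "bounded_linear (\<lambda>x. cinner (T x) y)"
      using T unfolding bounded_clinear_def
      by (blast intro: bounded_linear_compose[OF bounded_linear_cinner_left])
    then have "closed N"
      unfolding N_def
      by (intro closed_Collect_eq continuous_on_const linear_continuous_on)
    show ?thesis
    proof (cases "N = UNIV")
      case True
      then show ?thesis unfolding N_def by (intro exI[of _ 0]) auto
    next
      case False
      then obtain u where u: "u \<notin> N" by blast
      obtain p where p: "p \<in> N" "\<And>v. v \<in> N \<Longrightarrow> cinner (u - p) v = 0"
        using orthogonal_projection_exists[OF N \<open>closed N\<close>] by metis
      define w where "w = u - p"
      define c where "c = cinner (T w) y"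
      have c: "c \<noteq> 0"
        using u p(1) by (simp add: c_def w_def N_def bounded_clinear_linear[OF T] cinner_diff_left)
      then have w: "w \<noteq> 0" by (auto simp: c_def bounded_clinear_linear[OF T])
      have "cinner (T x) y = cinner x ((cnj c / cinner w w) *\<^sub>C w)" for x
      proof -
        \<comment> \<open>Removing the right multiple of \<open>w\<close> puts any \<open>x\<close>
          into the kernel; pairing the result with \<open>w\<close> reads off the representing
          vector.\<close>
        have "x - (cinner (T x) y / c) *\<^sub>C w \<in> N"
          using c by (simp add: N_def bounded_clinear_linear[OF T] cinner_diff_left
              cinner_scaleC_left flip: c_def)
        then have "cinner (x - (cinner (T x) y / c) *\<^sub>C w) w = 0"
          using p(2) cinner_eq_0_commute w_def by blast
        then show ?thesis
          using c w by (simp add: cinner_diff_left cinner_scaleC_left cinner_scaleC_right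
              cinner_self field_simps)
      qed
      then show ?thesis by blast
    qed
  qed
  then show ?thesis by metis
qed

lemma cadjoint_eqI:
  assumes "\<And>x y. cinner (T x) y = cinner x (S y)"
  shows "cadjoint T = S"
  unfolding cadjoint_def
proof (rule the_equality)
  fix R assume R: "\<forall>x y. cinner (T x) y = cinner x (R y)"
  show "R = S"
  proof
    fix y
    have "cinner (R y - S y) (R y - S y) = 0"
      using R assms by (metis cinner_diff_right right_minus_eq)
    then show "R y = S y" by (simp add: cinner_self_eq_0_iff)
  qed
qed (use assms in blast)

text \<open>\<open>cadjoint\<close> is a definite description, so \<open>cadjoint T = T\<close>
  gives the symmetry identity only because an adjoint exists.\<close>

lemma selfadjoint_op_iff:
  "selfadjoint_op T \<longleftrightarrow> bounded_clinear T \<and> (\<forall>x y. cinner (T x) y = cinner x (T y))"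
  unfolding selfadjoint_op_def using adjoint_exists[of T] cadjoint_eqI[of T] by metis

section \<open>Eigenvectors of absolutely norm attaining operators\<close>

definition orthonormal :: "'a :: complex_inner set \<Rightarrow> bool"
  where "orthonormal E \<longleftrightarrow> (\<forall>e\<in>E. \<forall>f\<in>E. cinner e f = (if e = f then 1 else 0))"

lemma orthonormal_cinner:
  "orthonormal E \<Longrightarrow> e \<in> E \<Longrightarrow> f \<in> E \<Longrightarrow> cinner e f = (if e = f then 1 else 0)"
  by (simp add: orthonormal_def)

lemma norm_eq_1_iff_cinner: "norm e = 1 \<longleftrightarrow> cinner e e = (1 :: complex)" for e :: "'a :: complex_inner"
proof -
  have "cinner e e = 1 \<longleftrightarrow> (norm e)\<^sup>2 = 1"
    unfolding cinner_self by (simp only: of_real_eq_1_iff)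
  then show ?thesis by (simp add: power2_eq_1_iff) (use norm_ge_zero[of e] in linarith)
qed

lemma orthonormal_norm: "orthonormal E \<Longrightarrow> e \<in> E \<Longrightarrow> norm e = 1"
  by (simp add: norm_eq_1_iff_cinner orthonormal_cinner)

text \<open>Boundedness of \<open>T\<close> makes the supremum in \<open>onorm_on\<close> a genuine
  upper bound; from here on only the maximiser inequality is used.\<close>

lemma norm_attaining_onE:
  fixes M :: "'a :: chilbert_space set"
  assumes "bounded_clinear T" "norm_attaining_on M T"
  obtains x where "x \<in> M" "norm x = 1" "\<And>y. y \<in> M \<Longrightarrow> norm (T y) \<le> norm (T x) * norm y"
proof -
  obtain x where x: "x \<in> M" "norm x = 1" "norm (T x) = onorm_on M T"
    using assms(2) unfolding norm_attaining_on_def by blast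
  obtain B where B: "0 < B" "\<And>x. norm (T x) \<le> B * norm x"
    using bounded_clinear_bounded[OF assms(1)] by blast
  have bdd: "bdd_above ((\<lambda>y. norm (T y) / norm y) ` M)"
    by (rule bdd_aboveI2[of _ _ B]) (use B in \<open>simp add: divide_le_eq\<close>)
  have "norm (T y) \<le> norm (T x) * norm y" if "y \<in> M" for y
  proof (cases "y = 0")
    case True
    then show ?thesis using bounded_clinear_linear(3)[OF assms(1)] by simp
  next
    case False
    have "norm (T y) / norm y \<le> onorm_on M T"
      unfolding onorm_on_def by (rule cSUP_upper[OF that bdd])
    then show ?thesis using False x(3) by (simp add: divide_le_eq)
  qed
  with x show ?thesis using that by blast
qed

text \<open>First variation of the quotient of \<open>(norm (T y))\<^sup>2\<close> by \<open>(norm y)\<^sup>2\<close> at a maximiser.\<close>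

lemma cinner_image_maximiser:
  fixes M :: "'a :: chilbert_space set"
  assumes T: "bounded_clinear T" and M: "cvec.subspace M"
    and x: "x \<in> M" "norm x = 1" and max: "\<And>y. y \<in> M \<Longrightarrow> norm (T y) \<le> norm (T x) * norm y"
    and y: "y \<in> M"
  shows "cinner (T x) (T y) = complex_of_real ((norm (T x))\<^sup>2) * cinner x y"
proof -
  define s where "s = norm (T x)"
  have re: "inner (T x) (T z) = s\<^sup>2 * inner x z" if z: "z \<in> M" for z
  proof -
    have le: "inner (T w) (T w) \<le> s\<^sup>2 * inner w w" if "w \<in> M" for w
    proof -
      have "(norm (T w))\<^sup>2 \<le> (s * norm w)\<^sup>2"
        using max[OF that] by (intro power_mono) (simp_all add: s_def)
      then show ?thesis by (simp add: power_mult_distrib power2_norm_eq_inner)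
    qed
    have eq: "inner (T x) (T x) = s\<^sup>2 * inner x x"
      using x(2) by (simp add: s_def flip: power2_norm_eq_inner)
    have "s\<^sup>2 * inner x z - inner (T x) (T z) = 0"
    \<comment> \<open>Along \<open>x + t *\<^sub>R z\<close> the difference of the two sides of
      \<open>le\<close> is a quadratic in \<open>t\<close>, nonnegative everywhere and zero at
      \<open>t = 0\<close> by \<open>eq\<close>.\<close>
    proof (rule linear_term_vanishes)
      show "0 \<le> s\<^sup>2 * inner z z - inner (T z) (T z)" using le[OF z] by simp
      fix t :: real
      have "inner (T (x + t *\<^sub>R z)) (T (x + t *\<^sub>R z)) \<le> s\<^sup>2 * inner (x + t *\<^sub>R z) (x + t *\<^sub>R z)"
        by (intro le cvec.subspace_add subspace_scaleR M x z)
      then have "0 \<le> s\<^sup>2 * (inner x x + 2 * t * inner x z + t\<^sup>2 * inner z z)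
          - (inner (T x) (T x) + 2 * t * inner (T x) (T z) + t\<^sup>2 * inner (T z) (T z))"
        by (simp add: bounded_clinear_linear[OF T] inner_add_left inner_add_right inner_commute
            power2_eq_square algebra_simps)
      then show "0 \<le> 2 * t * (s\<^sup>2 * inner x z - inner (T x) (T z))
          + t\<^sup>2 * (s\<^sup>2 * inner z z - inner (T z) (T z))"
        by (simp add: eq algebra_simps)
    qed
    then show ?thesis by simp
  qed
  show ?thesis
    using re[OF y] re[OF cvec.subspace_scale[OF M y], of \<i>]
    by (simp add: cinner_conv_inner bounded_clinear_linear[OF T] complex_eq_iff s_def)
qed

text \<open>With \<open>s\<close> the attained norm, the first variation tested at
  \<open>z = T (T x) - s\<^sup>2 x\<close>, which lies in \<open>M\<close> by invariance, gives
  \<open>z = 0\<close>. Then \<open>(T - s) (T + s) x = 0\<close>: either \<open>(T + s) x\<close>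
  is an eigenvector for \<open>s\<close>, or it vanishes and \<open>x\<close> is one for
  \<open>- s\<close>.\<close>

lemma eigenvector_in_invariant_subspace:
  fixes M :: "'a :: chilbert_space set"
  assumes AN: "absolutely_norm_attaining T" and sa: "selfadjoint_op T"
    and M: "cvec.subspace M" "closed M" "M \<noteq> {0}" and inv: "\<And>y. y \<in> M \<Longrightarrow> T y \<in> M"
  obtains x \<mu> where "x \<in> M" "norm x = 1" "T x = complex_of_real \<mu> *\<^sub>C x"
proof -
  have T: "bounded_clinear T" and adj: "\<And>x y. cinner (T x) y = cinner x (T y)"
    using sa by (auto simp: selfadjoint_op_iff)
  have "norm_attaining_on M T" using AN M unfolding absolutely_norm_attaining_def by blast
  then obtain x where x: "x \<in> M" "norm x = 1"
    and max: "\<And>y. y \<in> M \<Longrightarrow> norm (T y) \<le> norm (T x) * norm y"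
    using norm_attaining_onE[OF T] by blast
  define s where "s = complex_of_real (norm (T x))"
  define z where "z = T (T x) - (s * s) *\<^sub>C x"
  have zM: "z \<in> M" unfolding z_def by (intro cvec.subspace_diff cvec.subspace_scale M inv x)
  have "cinner z z = cinner (T x) (T z) - s * s * cinner x z"
    by (subst (1) z_def) (simp add: cinner_diff_left cinner_scaleC_left adj)
  also have "\<dots> = 0"
    using cinner_image_maximiser[OF T M(1) x max zM] by (simp add: s_def power2_eq_square)
  finally have TT: "T (T x) = (s * s) *\<^sub>C x" by (simp add: cinner_self_eq_0_iff z_def)
  define w where "w = T x + s *\<^sub>C x"
  have wM: "w \<in> M" unfolding w_def by (intro cvec.subspace_add cvec.subspace_scale M inv x)
  have Tw: "T w = s *\<^sub>C w"
    by (simp add: w_def bounded_clinear_linear[OF T] TT scaleC_add_right scaleC_scaleC add.commute)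
  show ?thesis
  proof (cases "w = 0")
    case True
    then have "T x = complex_of_real (- norm (T x)) *\<^sub>C x"
      by (simp add: w_def s_def add_eq_0_iff2)
    with x show ?thesis using that by blast
  next
    case False
    define v where "v = complex_of_real (1 / norm w) *\<^sub>C w"
    have "T v = complex_of_real (norm (T x)) *\<^sub>C v"
      by (simp add: v_def bounded_clinear_linear[OF T] Tw s_def scaleC_scaleC mult.commute)
    moreover have "norm v = 1" using False by (simp add: v_def norm_divide)
    moreover have "v \<in> M" unfolding v_def by (intro cvec.subspace_scale M wM)
    ultimately show ?thesis using that by blast
  qed
qed

text \<open>Self-adjointness and real eigenvalues make the orthogonal complement of a set of
  eigenvectors invariant. For a maximal orthonormal set of eigenvectors this complement must be
  zero, since a further eigenvector in it would enlarge the set.\<close>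

lemma orthonormal_eigenbasis_exists:
  fixes T :: "'a :: chilbert_space \<Rightarrow> 'a"
  assumes AN: "absolutely_norm_attaining T" and sa: "selfadjoint_op T"
  obtains E :: "'a set" and \<mu> where "orthonormal E"
    "\<And>x. (\<And>e. e \<in> E \<Longrightarrow> cinner x e = 0) \<Longrightarrow> x = 0"
    "\<And>e. e \<in> E \<Longrightarrow> T e = complex_of_real (\<mu> e) *\<^sub>C e"
proof -
  have T: "bounded_clinear T" and adj: "\<And>x y. cinner (T x) y = cinner x (T y)"
    using sa by (auto simp: selfadjoint_op_iff)
  define \<A> where "\<A> = {E. orthonormal E \<and> (\<forall>e\<in>E. \<exists>r. T e = complex_of_real r *\<^sub>C e)}"
  have "\<exists>E\<in>\<A>. \<forall>X\<in>\<A>. E \<subseteq> X \<longrightarrow> X = E"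
  proof (rule subset_Zorn_nonempty)
    have "{} \<in> \<A>" by (simp add: \<A>_def orthonormal_def)
    then show "\<A> \<noteq> {}" by blast
    fix \<C> assume C: "\<C> \<noteq> {}" "subset.chain \<A> \<C>"
    have "orthonormal (\<Union>\<C>)"
      unfolding orthonormal_def
    proof (intro ballI)
      fix e f assume "e \<in> \<Union>\<C>" "f \<in> \<Union>\<C>"
      then obtain X Y where XY: "X \<in> \<C>" "e \<in> X" "Y \<in> \<C>" "f \<in> Y" by blast
      then have "X \<subseteq> Y \<or> Y \<subseteq> X" using C(2) by (simp add: subset_chain_def)
      with XY obtain Z where Z: "Z \<in> \<C>" "e \<in> Z" "f \<in> Z" by blast
      have "orthonormal Z" using C(2) Z(1) by (auto simp: subset_chain_def \<A>_def)
      then show "cinner e f = (if e = f then 1 else 0)" using Z(2,3) by (rule orthonormal_cinner)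
    qed
    moreover have "\<forall>e\<in>\<Union>\<C>. \<exists>r. T e = complex_of_real r *\<^sub>C e"
      using C(2) by (auto simp: subset_chain_def \<A>_def)
    ultimately show "\<Union>\<C> \<in> \<A>" unfolding \<A>_def by simp
  qed
  then obtain E where E: "E \<in> \<A>" and max: "\<And>X. X \<in> \<A> \<Longrightarrow> E \<subseteq> X \<Longrightarrow> X = E" by blast
  have oE: "orthonormal E" using E by (simp add: \<A>_def)
  have "\<forall>e\<in>E. \<exists>r. T e = complex_of_real r *\<^sub>C e" using E by (simp add: \<A>_def)
  then obtain \<mu> where \<mu>: "\<And>e. e \<in> E \<Longrightarrow> T e = complex_of_real (\<mu> e) *\<^sub>C e"
    by metis
  define M where "M = {x. \<forall>e\<in>E. cinner x e = 0}"
  have M: "cvec.subspace M" "closed M" using closed_subspace_orthogonal[of E] by (simp_all only: M_def)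
  have inv: "T y \<in> M" if "y \<in> M" for y
    using that by (simp add: M_def adj \<mu> cinner_scaleC_right)
  have "M = {0}"
  proof (rule ccontr)
    assume "M \<noteq> {0}"
    then obtain x r where x: "x \<in> M" "norm x = 1" "T x = complex_of_real r *\<^sub>C x"
      using eigenvector_in_invariant_subspace[OF AN sa M \<open>M \<noteq> {0}\<close> inv] by metis
    have "cinner x e = 0" "cinner e x = 0" if "e \<in> E" for e
      using x(1) that cinner_eq_0_commute[of x e] by (simp_all add: M_def)
    moreover have "cinner x x = 1" using x(2) norm_eq_1_iff_cinner by blast
    ultimately have "orthonormal (insert x E)"
      using oE by (auto simp: orthonormal_def)
    then have "insert x E \<in> \<A>" using E x(3) by (auto simp: \<A>_def)
    then have "x \<in> E" using max[of "insert x E"] by auto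
    then show False using x by (simp add: M_def norm_eq_1_iff_cinner)
  qed
  have "x = 0" if "\<And>e. e \<in> E \<Longrightarrow> cinner x e = 0" for x
  proof -
    have "x \<in> M" using that by (simp add: M_def)
    with \<open>M = {0}\<close> show ?thesis by simp
  qed
  with oE show ?thesis by (rule that[OF _ _ \<mu>])
qed

text \<open>At a maximiser \<open>x\<close> of the closed span,
  \<open>cinner (T x) (T (f n))\<close> equals \<open>cinner x (f n)\<close> times both
  \<open>(norm (T x))\<^sup>2\<close> and \<open>(norm (T (f n)))\<^sup>2\<close>. The second factor
  is strictly smaller, since \<open>f (Suc n)\<close> does better than \<open>f n\<close>. So
  \<open>x\<close> is orthogonal to every \<open>f n\<close>, hence to itself. The span need not be
  invariant under \<open>T\<close>; orthogonality of the images is enough.\<close>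

lemma no_strictly_increasing_compression:
  fixes f :: "nat \<Rightarrow> 'a :: chilbert_space"
  assumes AN: "absolutely_norm_attaining T"
    and ortho: "\<And>m n. m \<noteq> n \<Longrightarrow> cinner (f m) (f n) = 0" and unit: "\<And>n. norm (f n) = 1"
    and Tortho: "\<And>m n. m \<noteq> n \<Longrightarrow> cinner (T (f m)) (T (f n)) = 0"
    and less: "\<And>n. norm (T (f n)) < norm (T (f (Suc n)))"
  shows False
proof -
  have T: "bounded_clinear T" using AN by (simp add: absolutely_norm_attaining_def)
  then have cT: "continuous_on A T" for A
    unfolding bounded_clinear_def by (blast intro: linear_continuous_on)
  define M where "M = closure (cvec.span (range f))"
  have M: "cvec.subspace M" unfolding M_def by (rule closure_span_subspace)
  have fM: "f n \<in> M" for n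
    unfolding M_def by (intro subsetD[OF closure_subset] cvec.span_base rangeI)
  have "M \<noteq> {0}" using fM[of 0] unit[of 0] by auto
  moreover have "closed M" by (simp add: M_def)
  ultimately have "norm_attaining_on M T"
    using AN M by (simp add: absolutely_norm_attaining_def)
  then obtain x where x: "x \<in> M" "norm x = 1"
    and max: "\<And>y. y \<in> M \<Longrightarrow> norm (T y) \<le> norm (T x) * norm y"
    using norm_attaining_onE[OF T] by blast
  have "cinner x (f n) = 0" for n
  proof -
    define t where "t = complex_of_real ((norm (T (f n)))\<^sup>2)"
    \<comment> \<open>The relation holds at each \<open>f m\<close> by orthogonality; its solution
      set is a closed subspace, so it passes to \<open>M\<close>.\<close>
    define N where "N = {y. cinner (T y) (T (f n)) = t * cinner y (f n)}"
    have "closed N" unfolding N_def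
      by (intro closed_Collect_eq continuous_intros cT)
    moreover have "cvec.subspace N"
      unfolding N_def
      by (rule cvec.subspaceI)
        (auto simp: bounded_clinear_linear[OF T] cinner_add_left cinner_scaleC_left algebra_simps)
    moreover have "range f \<subseteq> N"
    proof -
      have "f m \<in> N" for m
        using ortho[of m n] Tortho[of m n] unit[of n]
        by (cases "m = n") (simp_all add: N_def t_def cinner_self)
      then show ?thesis by blast
    qed
    ultimately have "M \<subseteq> N"
      unfolding M_def by (intro closure_minimal cvec.span_minimal)
    then have "t * cinner x (f n) = cinner (T x) (T (f n))" using x(1) by (auto simp: N_def)
    also have "\<dots> = complex_of_real ((norm (T x))\<^sup>2) * cinner x (f n)"
      by (rule cinner_image_maximiser[OF T M x max fM])
    finally have "cinner x (f n) = 0 \<or> t = complex_of_real ((norm (T x))\<^sup>2)"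
      by simp
    moreover have "norm (T (f n)) < norm (T x)"
      using less[of n] max[OF fM[of "Suc n"]] unit[of "Suc n"] by simp
    then have "t \<noteq> complex_of_real ((norm (T x))\<^sup>2)"
      unfolding t_def of_real_eq_iff by simp
    ultimately show ?thesis by blast
  qed
  then have "range f \<subseteq> {y. \<forall>e\<in>{x}. cinner y e = 0}"
    using cinner_eq_0_commute[of x] by auto
  then have "M \<subseteq> {y. \<forall>e\<in>{x}. cinner y e = 0}"
    unfolding M_def
    using closed_subspace_orthogonal[of "{x}"] by (intro closure_minimal cvec.span_minimal)
  then have "cinner x x = 0" using x(1) by blast
  then show False using x(2) by (simp add: norm_eq_1_iff_cinner)
qed

section \<open>Operators diagonal in an orthonormal basis\<close>

text \<open>Stated through coefficients instead of eigenvectors or a series, so that sums, products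
  and scalar multiples act entrywise at once. For a total \<open>E\<close> the eigenvector form is
  equivalent. The entries are real, which makes these operators self-adjoint.\<close>

definition diagonal_op :: "'a set \<Rightarrow> ('a :: chilbert_space \<Rightarrow> 'a) \<Rightarrow> ('a \<Rightarrow> real) \<Rightarrow> bool"
  where "diagonal_op E S s \<longleftrightarrow> bounded_clinear S \<and>
    (\<forall>x. \<forall>e\<in>E. cinner (S x) e = complex_of_real (s e) * cinner x e)"

lemma diagonal_op_bounded: "diagonal_op E S s \<Longrightarrow> bounded_clinear S"
  by (simp add: diagonal_op_def)

lemma diagonal_op_cinner:
  "diagonal_op E S s \<Longrightarrow> e \<in> E \<Longrightarrow> cinner (S x) e = complex_of_real (s e) * cinner x e"
  by (simp add: diagonal_op_def)

lemma diagonal_op_cong: "(\<And>e. e \<in> E \<Longrightarrow> s e = r e) \<Longrightarrow> diagonal_op E S s \<Longrightarrow> diagonal_op E S r"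
  by (simp add: diagonal_op_def)

lemma diagonal_op_compose:
  "diagonal_op E S s \<Longrightarrow> diagonal_op E R r \<Longrightarrow> diagonal_op E (\<lambda>x. S (R x)) (\<lambda>e. s e * r e)"
  by (auto simp: diagonal_op_def intro: bounded_clinear_compose)

lemma diagonal_op_add:
  "diagonal_op E S s \<Longrightarrow> diagonal_op E R r \<Longrightarrow> diagonal_op E (\<lambda>x. S x + R x) (\<lambda>e. s e + r e)"
  by (auto simp: diagonal_op_def cinner_add_left algebra_simps intro: bounded_clinear_add)

lemma diagonal_op_diff:
  "diagonal_op E S s \<Longrightarrow> diagonal_op E R r \<Longrightarrow> diagonal_op E (\<lambda>x. S x - R x) (\<lambda>e. s e - r e)"
  by (auto simp: diagonal_op_def cinner_diff_left algebra_simps intro: bounded_clinear_diff)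

lemma diagonal_op_scaleC:
  "diagonal_op E S s \<Longrightarrow> diagonal_op E (\<lambda>x. complex_of_real r *\<^sub>C S x) (\<lambda>e. r * s e)"
  by (auto simp: diagonal_op_def cinner_scaleC_left intro: bounded_clinear_scaleC)

lemma diagonal_op_zero: "diagonal_op E (\<lambda>x. 0) (\<lambda>e. 0)"
  by (simp add: diagonal_op_def bounded_clinear_zero)

lemma diagonal_op_ident: "diagonal_op E (\<lambda>x. x) (\<lambda>e. 1)"
  by (simp add: diagonal_op_def bounded_clinear_ident)

lemma diagonal_op_finite_sum:
  assumes "orthonormal E" "finite G" "G \<subseteq> E"
  shows "diagonal_op E (\<lambda>x. \<Sum>g\<in>G. complex_of_real (s g) *\<^sub>C cinner x g *\<^sub>C g)
    (\<lambda>e. if e \<in> G then s e else 0)"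
  unfolding diagonal_op_def
proof (intro conjI allI ballI)
  show "bounded_clinear (\<lambda>x. \<Sum>g\<in>G. complex_of_real (s g) *\<^sub>C cinner x g *\<^sub>C g)"
    by (intro bounded_clinear_sum bounded_clinear_scaleC bounded_clinear_rank_one)
  fix x e assume e: "e \<in> E"
  have "cinner (\<Sum>g\<in>G. complex_of_real (s g) *\<^sub>C cinner x g *\<^sub>C g) e
      = (\<Sum>g\<in>G. if g = e then complex_of_real (s e) * cinner x e else 0)"
    unfolding cinner_sum_left cinner_scaleC_left
    using assms(3) e by (intro sum.cong) (auto simp: orthonormal_cinner[OF assms(1)])
  also have "\<dots> = complex_of_real (if e \<in> G then s e else 0) * cinner x e"
    using assms(2) by simp
  finally show "cinner (\<Sum>g\<in>G. complex_of_real (s g) *\<^sub>C cinner x g *\<^sub>C g) e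
      = complex_of_real (if e \<in> G then s e else 0) * cinner x e" .
qed

locale orthonormal_basis =
  fixes E :: "'a :: chilbert_space set"
  assumes orthonormal: "orthonormal E"
    and total: "\<And>x. (\<And>e. e \<in> E \<Longrightarrow> cinner x e = 0) \<Longrightarrow> x = 0"
begin

lemma eqI: "(\<And>e. e \<in> E \<Longrightarrow> cinner x e = cinner y e) \<Longrightarrow> x = y"
  using total[of "x - y"] by (simp add: cinner_diff_left)

lemma subspace_eq_UNIV: "cvec.subspace M \<Longrightarrow> closed M \<Longrightarrow> E \<subseteq> M \<Longrightarrow> M = UNIV"
  using closed_subspace_eq_UNIV total by blast

lemma diagonal_op_eqI:
  "diagonal_op E S s \<Longrightarrow> diagonal_op E R r \<Longrightarrow> (\<And>e. e \<in> E \<Longrightarrow> s e = r e) \<Longrightarrow> S = R"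
  by (rule ext, rule eqI) (simp add: diagonal_op_cinner)

lemma diagonal_op_eigenvector:
  assumes "diagonal_op E S s" "e \<in> E"
  shows "S e = complex_of_real (s e) *\<^sub>C e"
  by (rule eqI)
    (use assms in \<open>auto simp: diagonal_op_cinner cinner_scaleC_left orthonormal_cinner[OF orthonormal]\<close>)

text \<open>For fixed \<open>e\<close> the vectors with the right coefficient at \<open>e\<close>
  form a closed subspace containing the basis.\<close>

lemma diagonal_opI:
  assumes S: "bounded_clinear S" and eig: "\<And>e. e \<in> E \<Longrightarrow> S e = complex_of_real (s e) *\<^sub>C e"
  shows "diagonal_op E S s"
  unfolding diagonal_op_def
proof (intro conjI allI ballI S)
  fix x e assume e: "e \<in> E"
  define M where "M = {x. cinner (S x) e = complex_of_real (s e) * cinner x e}"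
  have cS: "continuous_on A S" for A
    using S unfolding bounded_clinear_def by (blast intro: linear_continuous_on)
  have "M = UNIV"
  proof (rule subspace_eq_UNIV)
    show "closed M" unfolding M_def
      by (intro closed_Collect_eq continuous_intros cS)
    show "cvec.subspace M"
      unfolding M_def
      by (rule cvec.subspaceI)
        (auto simp: bounded_clinear_linear[OF S] cinner_add_left cinner_scaleC_left algebra_simps)
    show "E \<subseteq> M"
      using e by (auto simp: M_def eig cinner_scaleC_left orthonormal_cinner[OF orthonormal])
  qed
  then show "cinner (S x) e = complex_of_real (s e) * cinner x e" unfolding M_def by blast
qed

text \<open>Density in the second argument: at a basis vector the identity is the coefficient
  formula, as the entries are real.\<close>

lemma diagonal_op_adjoint:
  assumes S: "diagonal_op E S s"
  shows "cinner (S x) y = cinner x (S y)"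
proof -
  note S' = diagonal_op_bounded[OF S]
  define M where "M = {y. cinner (S x) y = cinner x (S y)}"
  have cS: "continuous_on A S" for A
    using S' unfolding bounded_clinear_def by (blast intro: linear_continuous_on)
  have "M = UNIV"
  proof (rule subspace_eq_UNIV)
    show "closed M" unfolding M_def
      by (intro closed_Collect_eq continuous_intros cS)
    show "cvec.subspace M"
      unfolding M_def
      by (rule cvec.subspaceI)
        (auto simp: bounded_clinear_linear[OF S'] cinner_add_right cinner_scaleC_right)
    show "E \<subseteq> M"
      using S by (auto simp: M_def diagonal_op_eigenvector diagonal_op_cinner cinner_scaleC_right)
  qed
  then show ?thesis unfolding M_def by blast
qed

lemma diagonal_op_selfadjoint: "diagonal_op E S s \<Longrightarrow> selfadjoint_op S"
  by (simp add: selfadjoint_op_iff diagonal_op_bounded diagonal_op_adjoint)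

lemma span_expansion:
  assumes "x \<in> cvec.span E"
  obtains G where "finite G" "G \<subseteq> E" "x = (\<Sum>g\<in>G. cinner x g *\<^sub>C g)"
proof -
  obtain G c where G: "finite G" "G \<subseteq> E" "x = (\<Sum>g\<in>G. c g *\<^sub>C g)"
    using assms unfolding cvec.span_explicit by auto
  have "cinner x h = c h" if "h \<in> G" for h
  proof -
    have "cinner x h = (\<Sum>g\<in>G. if g = h then c h else 0)"
      unfolding G(3) cinner_sum_left cinner_scaleC_left
      using that by (intro sum.cong) (simp_all add: subsetD[OF G(2)] orthonormal_cinner[OF orthonormal])
    then show ?thesis using G(1) that by simp
  qed
  then have "(\<Sum>g\<in>G. cinner x g *\<^sub>C g) = (\<Sum>g\<in>G. c g *\<^sub>C g)"
    by (intro sum.cong) simp_all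
  with G(3) have "x = (\<Sum>g\<in>G. cinner x g *\<^sub>C g)" by simp
  with G show ?thesis using that by blast
qed

text \<open>On the algebraic span the quadratic form is a finite sum of terms
  \<open>s g * (cmod (cinner x g))\<^sup>2\<close>. Nonnegativity is a closed condition but does not
  define a subspace, so it is extended from the whole dense span and not from the basis
  alone.\<close>

lemma diagonal_op_nonneg:
  assumes S: "diagonal_op E S s" and s: "\<And>e. e \<in> E \<Longrightarrow> 0 \<le> s e"
  shows "0 \<le> Re (cinner (S x) x)"
proof -
  note S' = diagonal_op_bounded[OF S]
  have cS: "continuous_on A S" for A
    using S' unfolding bounded_clinear_def by (blast intro: linear_continuous_on)
  have "closure (cvec.span E) = UNIV"
    by (rule subspace_eq_UNIV[OF closure_span_subspace closed_closure])
      (rule order_trans[OF cvec.span_superset closure_subset])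
  moreover have "closure (cvec.span E) \<subseteq> {x. 0 \<le> inner (S x) x}"
  proof (rule closure_minimal)
    show "closed {x. 0 \<le> inner (S x) x}"
      by (intro closed_Collect_le continuous_intros cS)
    show "cvec.span E \<subseteq> {x. 0 \<le> inner (S x) x}"
    proof
      fix x assume "x \<in> cvec.span E"
      then obtain G where G: "finite G" "G \<subseteq> E" "x = (\<Sum>g\<in>G. cinner x g *\<^sub>C g)"
        by (rule span_expansion)
      have "cinner x (S x) = (\<Sum>g\<in>G. cinner x g * cinner g (S x))"
        by (subst (1) G(3)) (simp add: cinner_sum_left cinner_scaleC_left)
      also have "\<dots> = (\<Sum>g\<in>G. complex_of_real (s g * (cmod (cinner x g))\<^sup>2))"
      proof (rule sum.cong)
        fix g assume "g \<in> G"
        then have "cinner g (S x) = complex_of_real (s g) * cnj (cinner x g)"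
          using G(2) diagonal_op_cinner[OF S, of g x] cinner_commute[of g "S x"] by auto
        then show "cinner x g * cinner g (S x) = complex_of_real (s g * (cmod (cinner x g))\<^sup>2)"
          by (simp add: mult.left_commute[of "cinner x g"] flip: complex_norm_square)
      qed simp
      finally have "inner (S x) x = (\<Sum>g\<in>G. s g * (cmod (cinner x g))\<^sup>2)"
        by (simp add: inner_eq_Re_cinner diagonal_op_adjoint[OF S])
      also have "\<dots> \<ge> 0" using G(2) s by (intro sum_nonneg) auto
      finally show "x \<in> {x. 0 \<le> inner (S x) x}" by simp
    qed
  qed
  ultimately show ?thesis by (auto simp flip: inner_eq_Re_cinner)
qed

lemma diagonal_op_positive:
  "diagonal_op E S s \<Longrightarrow> (\<And>e. e \<in> E \<Longrightarrow> 0 \<le> s e) \<Longrightarrow> positive_op S"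
  by (simp add: positive_op_def diagonal_op_selfadjoint diagonal_op_nonneg)

text \<open>The operator \<open>c\<^sup>2 - S\<^sup>2\<close> is diagonal with nonnegative entries,
  and its quadratic form is the difference of the squared bounds; this stands in for Parseval's
  identity.\<close>

lemma diagonal_op_norm_le:
  assumes S: "diagonal_op E S s" and s: "\<And>e. e \<in> E \<Longrightarrow> \<bar>s e\<bar> \<le> c" and "0 \<le> c"
  shows "norm (S x) \<le> c * norm x"
proof -
  have "diagonal_op E (\<lambda>x. complex_of_real (c\<^sup>2) *\<^sub>C x - S (S x)) (\<lambda>e. c\<^sup>2 * 1 - s e * s e)"
    by (intro diagonal_op_diff diagonal_op_scaleC diagonal_op_ident diagonal_op_compose S)
  moreover have "0 \<le> c\<^sup>2 * 1 - s e * s e" if "e \<in> E" for e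
    using mult_mono[OF s[OF that] s[OF that]] \<open>0 \<le> c\<close> by (simp add: power2_eq_square)
  ultimately have "0 \<le> Re (cinner (complex_of_real (c\<^sup>2) *\<^sub>C x - S (S x)) x)"
    by (rule diagonal_op_nonneg)
  also have "\<dots> = c\<^sup>2 * (norm x)\<^sup>2 - (norm (S x))\<^sup>2"
    unfolding cinner_diff_left cinner_scaleC_left diagonal_op_adjoint[OF S, of "S x" x] cinner_self
    by (simp only: of_real_mult[symmetric] of_real_diff[symmetric] Re_complex_of_real)
  also have "\<dots> = (c * norm x)\<^sup>2 - (norm (S x))\<^sup>2" by (simp add: power_mult_distrib)
  finally have "(norm (S x))\<^sup>2 \<le> (c * norm x)\<^sup>2" by simp
  then show ?thesis by (rule power2_le_imp_le) (simp add: \<open>0 \<le> c\<close>)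
qed

end

section \<open>Finite dimensional subspaces and compactness\<close>

text \<open>Induction on \<open>G\<close>: each new vector adds the image of a closed disc, and a
  sum of two compact sets is compact. The ambient space may be infinite dimensional, so closed and
  bounded would not suffice.\<close>

lemma compact_bounded_combinations:
  fixes G :: "'a :: complex_inner set"
  assumes "finite G"
  shows "compact {x. \<exists>z. (\<forall>g\<in>G. cmod (z g) \<le> r) \<and> x = (\<Sum>g\<in>G. z g *\<^sub>C g)}"
  using assms
proof (induction G)
  case empty
  then show ?case by simp
next
  case (insert h G)
  let ?C = "\<lambda>G. {x. \<exists>z. (\<forall>g\<in>G. cmod (z g) \<le> r) \<and> x = (\<Sum>g\<in>G. z g *\<^sub>C g)}"
  have "compact ((\<lambda>c. c *\<^sub>C h) ` cball 0 r)"
    by (intro compact_continuous_image linear_continuous_on bounded_linear_scaleC_left compact_cball)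
  then have "compact {x + y | x y. x \<in> (\<lambda>c. c *\<^sub>C h) ` cball 0 r \<and> y \<in> ?C G}"
    by (rule compact_sums) (rule insert.IH)
  also have "{x + y | x y. x \<in> (\<lambda>c. c *\<^sub>C h) ` cball 0 r \<and> y \<in> ?C G} = ?C (insert h G)"
  proof (intro equalityI subsetI)
    fix v assume "v \<in> {x + y | x y. x \<in> (\<lambda>c. c *\<^sub>C h) ` cball 0 r \<and> y \<in> ?C G}"
    then obtain c z where c: "cmod c \<le> r" and z: "\<forall>g\<in>G. cmod (z g) \<le> r"
      and v: "v = c *\<^sub>C h + (\<Sum>g\<in>G. z g *\<^sub>C g)" by auto
    have "(\<Sum>g\<in>G. (z(h := c)) g *\<^sub>C g) = (\<Sum>g\<in>G. z g *\<^sub>C g)"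
      using insert.hyps(2) by (intro sum.cong) auto
    then have "v = (\<Sum>g\<in>insert h G. (z(h := c)) g *\<^sub>C g)"
      using v insert.hyps by simp
    moreover have "\<forall>g\<in>insert h G. cmod ((z(h := c)) g) \<le> r" using c z by simp
    ultimately show "v \<in> ?C (insert h G)" by blast
  next
    fix v assume "v \<in> ?C (insert h G)"
    then obtain z where z: "\<forall>g\<in>insert h G. cmod (z g) \<le> r" "v = (\<Sum>g\<in>insert h G. z g *\<^sub>C g)"
      by blast
    have "v = z h *\<^sub>C h + (\<Sum>g\<in>G. z g *\<^sub>C g)" using z(2) insert.hyps by simp
    moreover have "z h *\<^sub>C h \<in> (\<lambda>c. c *\<^sub>C h) ` cball 0 r" using z(1) by (intro imageI) simp
    moreover have "(\<Sum>g\<in>G. z g *\<^sub>C g) \<in> ?C G" using z(1) by auto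
    ultimately show "v \<in> {x + y | x y. x \<in> (\<lambda>c. c *\<^sub>C h) ` cball 0 r \<and> y \<in> ?C G}" by blast
  qed
  finally show ?case .
qed

text \<open>A finite set \<open>Z\<close> that separates the points of \<open>M\<close> bounds its
  dimension. Imposing orthogonality to one \<open>e\<close> of \<open>Z\<close> lowers the dimension
  by at most one, and a Gram-Schmidt step restores the lost direction.\<close>

lemma finite_orthonormal_basis:
  fixes M :: "'a :: complex_inner set"
  assumes "finite Z" "cvec.subspace M"
    and "\<And>x. x \<in> M \<Longrightarrow> (\<And>e. e \<in> Z \<Longrightarrow> cinner x e = 0) \<Longrightarrow> x = 0"
  shows "\<exists>B. finite B \<and> orthonormal B \<and> B \<subseteq> M \<and> (\<forall>x\<in>M. x = (\<Sum>b\<in>B. cinner x b *\<^sub>C b))"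
  using assms
proof (induction Z arbitrary: M)
  case empty
  then have "M \<subseteq> {0}" by auto
  then show ?case by (intro exI[of _ "{}"]) (auto simp: orthonormal_def)
next
  case (insert e Z)
  define M' where "M' = {x \<in> M. cinner x e = 0}"
  have M': "cvec.subspace M'"
    using insert.prems(1) unfolding M'_def cvec.subspace_def
    by (simp add: cinner_add_left cinner_scaleC_left)
  have "\<exists>B. finite B \<and> orthonormal B \<and> B \<subseteq> M' \<and> (\<forall>x\<in>M'. x = (\<Sum>b\<in>B. cinner x b *\<^sub>C b))"
  proof (rule insert.IH[OF M'])
    fix x assume "x \<in> M'" "\<And>f. f \<in> Z \<Longrightarrow> cinner x f = 0"
    then show "x = 0" using insert.prems(2)[of x] by (auto simp: M'_def)
  qed
  then obtain B where B: "finite B" "orthonormal B" "B \<subseteq> M'"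
    and exp: "\<And>x. x \<in> M' \<Longrightarrow> x = (\<Sum>b\<in>B. cinner x b *\<^sub>C b)" by blast
  show ?case
  proof (cases "M \<subseteq> M'")
    case True
    then have "B \<subseteq> M" "\<forall>x\<in>M. x = (\<Sum>b\<in>B. cinner x b *\<^sub>C b)"
      using B(3) exp by (auto simp: M'_def)
    with B show ?thesis by (intro exI[of _ B]) simp
  next
    case False
    then obtain y where y: "y \<in> M" "cinner y e \<noteq> 0" by (auto simp: M'_def)
    \<comment> \<open>The part of \<open>y\<close> orthogonal to \<open>B\<close>. Since
      \<open>B\<close> is orthogonal to \<open>e\<close>, it keeps the nonzero product of
      \<open>y\<close> with \<open>e\<close>.\<close>
    define u where "u = y - (\<Sum>b\<in>B. cinner y b *\<^sub>C b)"
    have Be: "cinner b e = 0" if "b \<in> B" for b using B(3) that by (auto simp: M'_def)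
    have ub: "cinner u b = 0" if "b \<in> B" for b
    proof -
      have "cinner (\<Sum>c\<in>B. cinner y c *\<^sub>C c) b = (\<Sum>c\<in>B. if c = b then cinner y b else 0)"
        unfolding cinner_sum_left cinner_scaleC_left
        using that by (intro sum.cong) (simp_all add: orthonormal_cinner[OF B(2)])
      then show ?thesis using that B(1) by (simp add: u_def cinner_diff_left)
    qed
    have ue: "cinner u e = cinner y e"
      by (simp add: u_def cinner_diff_left cinner_sum_left cinner_scaleC_left Be)
    have "u \<in> M"
      unfolding u_def using B(3)
      by (intro cvec.subspace_diff cvec.subspace_sum cvec.subspace_scale insert.prems(1) y)
        (auto simp: M'_def)
    have "u \<noteq> 0" using ue y by auto
    define w where "w = complex_of_real (1 / norm u) *\<^sub>C u"
    have wM: "w \<in> M" unfolding w_def by (intro cvec.subspace_scale insert.prems(1) \<open>u \<in> M\<close>)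
    have "norm w = 1" using \<open>u \<noteq> 0\<close> by (simp add: w_def norm_divide)
    then have ww: "cinner w w = 1" by (simp only: norm_eq_1_iff_cinner)
    have wb: "cinner w b = 0" if "b \<in> B" for b
      by (simp add: w_def cinner_scaleC_left ub[OF that])
    have bw: "cinner b w = 0" if "b \<in> B" for b
      using wb[OF that] cinner_eq_0_commute by blast
    have we: "cinner w e \<noteq> 0" using \<open>u \<noteq> 0\<close> y(2) by (simp add: w_def cinner_scaleC_left ue)
    have "w \<notin> B" using ww wb by auto
    have "orthonormal (insert w B)"
      using B(2) ww wb bw by (auto simp: orthonormal_def)
    moreover have "x = (\<Sum>b\<in>insert w B. cinner x b *\<^sub>C b)" if x: "x \<in> M" for x
    proof -
      \<comment> \<open>Chosen so that \<open>x - c *\<^sub>C w\<close> is orthogonal to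
        \<open>e\<close> and the expansion in \<open>B\<close> applies; \<open>c\<close> then turns
        out to be \<open>cinner x w\<close>.\<close>
      define c where "c = cinner x e / cinner w e"
      have "x - c *\<^sub>C w \<in> M'"
        using we x wM by (simp add: M'_def c_def cinner_diff_left cinner_scaleC_left
            cvec.subspace_diff[OF insert.prems(1)] cvec.subspace_scale[OF insert.prems(1)])
      then have "x - c *\<^sub>C w = (\<Sum>b\<in>B. cinner (x - c *\<^sub>C w) b *\<^sub>C b)" by (rule exp)
      also have "\<dots> = (\<Sum>b\<in>B. cinner x b *\<^sub>C b)"
        by (intro sum.cong) (simp_all add: cinner_diff_left cinner_scaleC_left wb)
      finally have *: "x = c *\<^sub>C w + (\<Sum>b\<in>B. cinner x b *\<^sub>C b)" by (simp add: algebra_simps)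
      have "cinner (\<Sum>b\<in>B. cinner x b *\<^sub>C b) w = 0"
        by (simp add: cinner_sum_left cinner_scaleC_left bw)
      then have "cinner x w = c"
        using arg_cong[OF *, of "\<lambda>v. cinner v w"] ww by (simp add: cinner_add_left cinner_scaleC_left)
      then show ?thesis using * B(1) \<open>w \<notin> B\<close> by simp
    qed
    ultimately show ?thesis
      using B wM by (intro exI[of _ "insert w B"]) (auto simp: M'_def)
  qed
qed

lemma norm_attaining_onI:
  fixes M :: "'a :: chilbert_space set"
  assumes "x \<in> M" "norm x = 1" "\<And>y. y \<in> M \<Longrightarrow> norm (T y) \<le> norm (T x) * norm y"
  shows "norm_attaining_on M T"
proof -
  have "onorm_on M T = norm (T x)"
    unfolding onorm_on_def
  proof (rule cSup_eq_maximum)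
    show "norm (T x) \<in> (\<lambda>x. norm (T x) / norm x) ` M"
      using assms(1,2) by (intro image_eqI[of _ _ x]) auto
    fix r assume "r \<in> (\<lambda>x. norm (T x) / norm x) ` M"
    then obtain y where y: "y \<in> M" "r = norm (T y) / norm y" by blast
    then show "r \<le> norm (T x)"
      using assms(3)[OF y(1)] by (cases "y = 0") (simp_all add: divide_le_eq)
  qed
  then show ?thesis unfolding norm_attaining_on_def using assms(1,2) by auto
qed

text \<open>A finite separating set \<open>Z\<close> makes \<open>M\<close> finite dimensional, so
  its unit sphere is compact and the continuous function \<open>norm (T x)\<close> has a maximum
  there.\<close>

lemma norm_attaining_on_finite_dimensional:
  fixes M :: "'a :: chilbert_space set"
  assumes T: "bounded_clinear T" and "finite Z" and M: "cvec.subspace M" "closed M" "M \<noteq> {0}"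
    and Z: "\<And>x. x \<in> M \<Longrightarrow> (\<And>e. e \<in> Z \<Longrightarrow> cinner x e = 0) \<Longrightarrow> x = 0"
  shows "norm_attaining_on M T"
proof -
  obtain B where B: "finite B" "orthonormal B" "B \<subseteq> M"
    and exp: "\<And>x. x \<in> M \<Longrightarrow> x = (\<Sum>b\<in>B. cinner x b *\<^sub>C b)"
    using finite_orthonormal_basis[OF \<open>finite Z\<close> M(1) Z] by metis
  define U where "U = M \<inter> sphere 0 1"
  let ?C = "{x. \<exists>z. (\<forall>g\<in>B. cmod (z g) \<le> 1) \<and> x = (\<Sum>g\<in>B. z g *\<^sub>C g)}"
  have "U \<subseteq> ?C"
  proof
    fix x assume "x \<in> U"
    then have x: "x \<in> M" "norm x = 1" by (auto simp: U_def)
    have "cmod (cinner x b) \<le> 1" if "b \<in> B" for b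
      using cinner_cauchy_schwarz[of x b] x(2) orthonormal_norm[OF B(2) that] by simp
    with exp[OF x(1)] show "x \<in> ?C" by blast
  qed
  moreover have "closed U" 
    unfolding U_def sphere_def by (intro closed_Int M(2) closed_Collect_eq continuous_intros)
  ultimately have "compact U"
    using compact_bounded_combinations[OF B(1), of 1] compact_Int_closed[of ?C U]
    by (simp add: Int_absorb1)
  have unit: "complex_of_real (1 / norm y) *\<^sub>C y \<in> U" if "y \<in> M" "y \<noteq> 0" for y
    using that by (simp add: U_def cvec.subspace_scale[OF M(1)] norm_divide)
  have "U \<noteq> {}"
  proof -
    obtain y where "y \<in> M" "y \<noteq> 0" using M(1,3) cvec.subspace_0 by blast
    then show ?thesis using unit by blast
  qed
  moreover have "continuous_on U (\<lambda>x. norm (T x))"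
    using T unfolding bounded_clinear_def by (intro continuous_intros linear_continuous_on) simp
  ultimately obtain x where x: "x \<in> U" and max: "\<And>y. y \<in> U \<Longrightarrow> norm (T y) \<le> norm (T x)"
    using continuous_attains_sup[OF \<open>compact U\<close>] by metis
  show ?thesis
  proof (rule norm_attaining_onI)
    show "x \<in> M" "norm x = 1" using x by (auto simp: U_def)
    fix y assume "y \<in> M"
    show "norm (T y) \<le> norm (T x) * norm y"
    proof (cases "y = 0")
      case True
      then show ?thesis by (simp add: bounded_clinear_linear[OF T])
    next
      case False
      have "norm (T (complex_of_real (1 / norm y) *\<^sub>C y)) \<le> norm (T x)"
        by (intro max unit \<open>y \<in> M\<close> False)
      then show ?thesis
        using False by (simp add: bounded_clinear_linear[OF T] norm_divide divide_le_eq)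
    qed
  qed
qed

context orthonormal_basis
begin

lemma diagonal_op_finite_rank:
  assumes S: "diagonal_op E S s" and fin: "finite {e \<in> E. s e \<noteq> 0}"
  shows "finite_rank_op S"
proof -
  let ?G = "{e \<in> E. s e \<noteq> 0}"
  have "S = (\<lambda>x. \<Sum>g\<in>?G. complex_of_real (s g) *\<^sub>C cinner x g *\<^sub>C g)"
    by (rule diagonal_op_eqI[OF S diagonal_op_finite_sum[OF orthonormal fin]]) auto
  then have "range S \<subseteq> cvec.span ?G"
    by (auto intro!: cvec.span_sum cvec.span_scale intro: cvec.span_base)
  then show ?thesis
    unfolding finite_rank_op_def using fin diagonal_op_bounded[OF S] by blast
qed

text \<open>Truncation to the finitely many large entries gives an operator \<open>R\<close>
  uniformly close to \<open>S\<close> on the unit ball, with the image of the ball inside a compact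
  set. Hence the image under \<open>S\<close> is totally bounded.\<close>

lemma diagonal_op_compact:
  assumes S: "diagonal_op E S s" and fin: "\<And>\<epsilon>. 0 < \<epsilon> \<Longrightarrow> finite {e \<in> E. \<epsilon> < \<bar>s e\<bar>}"
  shows "compact_op S"
proof -
  obtain b where b: "0 < b" "\<And>x. norm (S x) \<le> b * norm x"
    using bounded_clinear_bounded[OF diagonal_op_bounded[OF S]] by blast
  have "\<exists>k. finite k \<and> closure (S ` cball 0 1) \<subseteq> (\<Union>x\<in>k. ball x \<epsilon>)" if "0 < \<epsilon>" for \<epsilon>
  proof -
    define G where "G = {e \<in> E. \<epsilon> / 4 < \<bar>s e\<bar>}"
    have G: "finite G" "G \<subseteq> E" using fin[of "\<epsilon> / 4"] \<open>0 < \<epsilon>\<close> by (auto simp: G_def)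
    define R where "R = (\<lambda>x. \<Sum>g\<in>G. complex_of_real (s g) *\<^sub>C cinner x g *\<^sub>C g)"
    have SR: "diagonal_op E (\<lambda>x. S x - R x) (\<lambda>e. s e - (if e \<in> G then s e else 0))"
      unfolding R_def by (intro diagonal_op_diff S diagonal_op_finite_sum orthonormal G)
    have close: "norm (S x - R x) \<le> \<epsilon> / 4 * norm x" for x
      using \<open>0 < \<epsilon>\<close> by (intro diagonal_op_norm_le[OF SR]) (auto simp: G_def)
    let ?C = "{x. \<exists>z. (\<forall>g\<in>G. cmod (z g) \<le> b) \<and> x = (\<Sum>g\<in>G. z g *\<^sub>C g)}"
    have RC: "R x \<in> ?C" if "norm x \<le> 1" for x
    proof -
      have "cmod (cinner (S x) g) \<le> b" if "g \<in> G" for g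
      proof -
        have "cmod (cinner (S x) g) \<le> norm (S x) * 1"
          using cinner_cauchy_schwarz[of "S x" g] orthonormal_norm[OF orthonormal, of g] G(2) that
          by auto
        also have "\<dots> \<le> b * norm x" using b(2) by simp
        also have "\<dots> \<le> b" using b(1) \<open>norm x \<le> 1\<close> by (simp add: mult_left_le)
        finally show ?thesis .
      qed
      moreover have "R x = (\<Sum>g\<in>G. cinner (S x) g *\<^sub>C g)"
        unfolding R_def using G(2)
        by (intro sum.cong) (auto simp: diagonal_op_cinner[OF S] scaleC_scaleC)
      ultimately show ?thesis by blast
    qed
    obtain k where k: "finite k" "?C \<subseteq> (\<Union>x\<in>k. ball x (\<epsilon> / 4))"
      using compact_bounded_combinations[OF G(1), of b] \<open>0 < \<epsilon>\<close>
      unfolding compact_eq_totally_bounded by (meson divide_pos_pos zero_less_numeral)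
    \<comment> \<open>A net of radius \<open>\<epsilon> / 4\<close> plus a truncation error of
      \<open>\<epsilon> / 4\<close>. The finite union of closed balls is closed, so it also covers
      the closure, and the rest of \<epsilon> makes the balls open again.\<close>
    have "closure (S ` cball 0 1) \<subseteq> (\<Union>x\<in>k. cball x (\<epsilon> / 2))"
    proof (rule closure_minimal)
      show "closed (\<Union>x\<in>k. cball x (\<epsilon> / 2))" using k(1) by (intro closed_UN) auto
      show "S ` cball 0 1 \<subseteq> (\<Union>x\<in>k. cball x (\<epsilon> / 2))"
      proof
        fix v assume "v \<in> S ` cball 0 1"
        then obtain x where x: "norm x \<le> 1" "v = S x" by auto
        have "R x \<in> (\<Union>x\<in>k. ball x (\<epsilon> / 4))" using k(2) RC[OF x(1)] by (rule subsetD)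
        then obtain y where y: "y \<in> k" "dist y (R x) < \<epsilon> / 4" by auto
        have "\<epsilon> / 4 * norm x \<le> \<epsilon> / 4 * 1"
          using x(1) \<open>0 < \<epsilon>\<close> by (intro mult_left_mono) simp_all
        then have "norm (S x - R x) \<le> \<epsilon> / 4" using close[of x] by linarith
        then have "dist y v \<le> \<epsilon> / 2"
          using y(2) dist_triangle[of y v "R x"] by (simp add: x(2) dist_norm norm_minus_commute)
        then show "v \<in> (\<Union>x\<in>k. cball x (\<epsilon> / 2))" using y(1) by auto
      qed
    qed
    also have "\<dots> \<subseteq> (\<Union>x\<in>k. ball x \<epsilon>)" using \<open>0 < \<epsilon>\<close> by fastforce
    finally show ?thesis using k(1) by blast
  qed
  then have "compact (closure (S ` cball 0 1))"
    unfolding compact_eq_totally_bounded by (simp add: complete_eq_closed)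
  then show ?thesis unfolding compact_op_def using diagonal_op_bounded[OF S] by blast
qed

section \<open>Diagonal form of the modulus and of the polar factor\<close>

text \<open>The projection to the complement of \<open>G\<close>. It serves to flip the signs of
  negative eigenvalues without functional calculus; linearity is read off the coefficients.\<close>

lemma diagonal_projection_exists:
  assumes "G \<subseteq> E"
  obtains P where "diagonal_op E P (\<lambda>e. if e \<in> G then 0 else 1)"
proof -
  define N where "N = {x. \<forall>e\<in>G. cinner x e = 0}"
  have N: "cvec.subspace N" "closed N"
    using closed_subspace_orthogonal[of G] by (simp_all only: N_def)
  have "\<forall>x. \<exists>p. p \<in> N \<and> (\<forall>y\<in>N. cinner (x - p) y = 0)"
    using orthogonal_projection_exists[OF N] by metis
  then obtain P where P: "\<And>x. P x \<in> N" "\<And>x y. y \<in> N \<Longrightarrow> cinner (x - P x) y = 0" by metis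
  have coef: "cinner (P x) e = complex_of_real (if e \<in> G then 0 else 1) * cinner x e" if "e \<in> E" for x e
  proof (cases "e \<in> G")
    case True
    then show ?thesis using P(1)[of x] by (simp add: N_def)
  next
    case False
    have "e \<in> N"
      using False \<open>e \<in> E\<close> assms by (auto simp: N_def orthonormal_cinner[OF orthonormal])
    then have "cinner (x - P x) e = 0" by (rule P(2))
    with False show ?thesis by (simp add: cinner_diff_left)
  qed
  have add: "P (x + y) = P x + P y" for x y
    by (rule eqI) (simp add: coef cinner_add_left)
  have scale: "P (c *\<^sub>C x) = c *\<^sub>C P x" for c x
    by (rule eqI) (simp add: coef cinner_scaleC_left)
  have le: "norm (P x) \<le> norm x" for x
  proof -
    have "cinner (P x) (P x) = cinner x (P x)"
      using P(2)[OF P(1), of x x] by (simp add: cinner_diff_left)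
    then have "norm (P x) * norm (P x) = cmod (cinner x (P x))"
      by (metis abs_of_nonneg cinner_self norm_of_real power2_eq_square zero_le_power2)
    then have "norm (P x) * norm (P x) \<le> norm x * norm (P x)"
      using cinner_cauchy_schwarz[of x "P x"] by simp
    then show ?thesis by (cases "P x = 0") simp_all
  qed
  have "bounded_linear P"
    by (rule bounded_linear_intro[of _ 1]) (simp_all add: add scaleR_scaleC scale le)
  then have "diagonal_op E P (\<lambda>e. if e \<in> G then 0 else 1)"
    using scale coef by (simp add: diagonal_op_def bounded_clinear_def)
  then show ?thesis by (rule that)
qed

text \<open>Any positive root \<open>S\<close> is shown to be diagonal, which settles the definite
  description in \<open>sqrt_op\<close>. For \<open>y = S e - m e\<close> with
  \<open>m = \<bar>\<mu> e\<bar>\<close>, the relation \<open>S (S e) = m\<^sup>2 e\<close> gives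
  \<open>S y = - m y\<close>, and positivity forces \<open>y = 0\<close> unless
  \<open>m = 0\<close>; in that case \<open>S (S e) = 0\<close> gives
  \<open>S e = 0\<close>.\<close>

lemma diagonal_op_sqrt_unique:
  assumes T: "diagonal_op E T \<mu>" and S: "positive_op S" "S \<circ> S = T \<circ> T"
  shows "diagonal_op E S (\<lambda>e. \<bar>\<mu> e\<bar>)"
proof (rule diagonal_opI)
  have bS: "bounded_clinear S" and adj: "\<And>x y. cinner (S x) y = cinner x (S y)"
    and pos: "\<And>x. 0 \<le> Re (cinner (S x) x)"
    using S(1) by (auto simp: positive_op_def selfadjoint_op_iff)
  show "bounded_clinear S" by fact
  note bT = diagonal_op_bounded[OF T]
  fix e assume e: "e \<in> E"
  define m where "m = complex_of_real \<bar>\<mu> e\<bar>"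
  have mm: "m * m = complex_of_real (\<mu> e) * complex_of_real (\<mu> e)"
    by (simp add: m_def flip: of_real_mult)
  have SS: "S (S e) = (m * m) *\<^sub>C e"
    using fun_cong[OF S(2), of e] diagonal_op_eigenvector[OF T e]
    by (simp add: mm bounded_clinear_linear[OF bT] scaleC_scaleC)
  define y where "y = S e - m *\<^sub>C e"
  have "S y = (- m) *\<^sub>C y"
    by (simp add: y_def bounded_clinear_linear[OF bS] SS scaleC_scaleC cvec.scale_right_diff_distrib)
  then have "cinner (S y) y = - m * complex_of_real ((norm y)\<^sup>2)"
    by (simp only: cinner_scaleC_left cinner_self)
  then have "Re (cinner (S y) y) = - (\<bar>\<mu> e\<bar> * (norm y)\<^sup>2)"
    by (simp add: m_def)
  then have "\<bar>\<mu> e\<bar> * (norm y)\<^sup>2 \<le> 0" using pos[of y] by simp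
  then have "\<mu> e = 0 \<or> y = 0"
    by (auto simp: mult_le_0_iff)
  then have "y = 0"
  proof
    assume "\<mu> e = 0"
    then have "m = 0" by (simp add: m_def)
    then have "cinner (S e) (S e) = 0" using SS adj[of e "S e"] by simp
    then show "y = 0" using \<open>m = 0\<close> by (simp add: y_def cinner_self_eq_0_iff)
  qed
  then show "S e = complex_of_real \<bar>\<mu> e\<bar> *\<^sub>C e" by (simp add: y_def m_def)
qed

lemma diagonal_abs_op:
  assumes T: "diagonal_op E T \<mu>"
  shows "diagonal_op E (abs_op T) (\<lambda>e. \<bar>\<mu> e\<bar>)"
proof -
  obtain P where P: "diagonal_op E P (\<lambda>e. if e \<in> {e \<in> E. \<mu> e < 0} then 0 else 1)"
    using diagonal_projection_exists[of "{e \<in> E. \<mu> e < 0}"] by blast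
  \<comment> \<open>\<open>P\<close> removes the eigenvectors with negative eigenvalue, so the
    entries are \<open>2 * \<mu> e - \<mu> e\<close> or \<open>0 - \<mu> e\<close>, that is
    \<open>\<bar>\<mu> e\<bar>\<close>.\<close>
  define R where "R = (\<lambda>x. complex_of_real 2 *\<^sub>C T (P x) - T x)"
  have "diagonal_op E R (\<lambda>e. 2 * (\<mu> e * (if e \<in> {e \<in> E. \<mu> e < 0} then 0 else 1)) - \<mu> e)"
    unfolding R_def by (intro diagonal_op_diff diagonal_op_scaleC diagonal_op_compose T P)
  then have R: "diagonal_op E R (\<lambda>e. \<bar>\<mu> e\<bar>)"
    by (rule diagonal_op_cong[rotated]) auto
  have RR: "R \<circ> R = T \<circ> T"
    unfolding comp_def
    by (rule diagonal_op_eqI[OF diagonal_op_compose[OF R R] diagonal_op_compose[OF T T]]) simp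
  have "cadjoint T = T" using diagonal_op_selfadjoint[OF T] by (simp add: selfadjoint_op_def)
  moreover have "sqrt_op (T \<circ> T) = R"
    unfolding sqrt_op_def
  proof (rule the_equality)
    show "positive_op R \<and> R \<circ> R = T \<circ> T"
      using RR diagonal_op_positive[OF R] by simp
    fix S assume "positive_op S \<and> S \<circ> S = T \<circ> T"
    then have "diagonal_op E S (\<lambda>e. \<bar>\<mu> e\<bar>)" using diagonal_op_sqrt_unique[OF T] by blast
    then show "S = R" using R by (rule diagonal_op_eqI) simp
  qed
  ultimately show ?thesis using R by (simp add: abs_op_def)
qed

text \<open>At an eigenvector with nonzero eigenvalue, \<open>T = V \<circ> abs_op T\<close> can be
  divided by \<open>\<bar>\<mu> e\<bar>\<close>; at the others the equality of null spaces gives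
  \<open>V e = 0\<close>.\<close>

lemma diagonal_polar_decomposition:
  assumes T: "diagonal_op E T \<mu>" and V: "polar_decomposition T V"
  shows "diagonal_op E V (\<lambda>e. sgn (\<mu> e))"
proof (rule diagonal_opI)
  have bV: "bounded_clinear V" and null: "null_space V = null_space T" and TV: "T = V \<circ> abs_op T"
    using V by (simp_all add: polar_decomposition_def partial_isometry_def)
  show "bounded_clinear V" by fact
  fix e assume e: "e \<in> E"
  note Te = diagonal_op_eigenvector[OF T e]
  show "V e = complex_of_real (sgn (\<mu> e)) *\<^sub>C e"
  proof (cases "\<mu> e = 0")
    case True
    then have "e \<in> null_space T" using Te by (simp add: null_space_def)
    then have "V e = 0" unfolding null[symmetric] by (simp add: null_space_def)
    with True show ?thesis by simp
  next
    case False
    define m where "m = complex_of_real \<bar>\<mu> e\<bar>"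
    have "m \<noteq> 0" using False by (simp add: m_def)
    have "T e = V (abs_op T e)" using fun_cong[OF TV, of e] by simp
    then have "complex_of_real (\<mu> e) *\<^sub>C e = m *\<^sub>C V e"
      by (simp add: Te diagonal_op_eigenvector[OF diagonal_abs_op[OF T] e]
          bounded_clinear_linear[OF bV] m_def)
    from arg_cong[OF this, of "\<lambda>v. (1 / m) *\<^sub>C v"]
    have "(complex_of_real (\<mu> e) / m) *\<^sub>C e = V e"
      using \<open>m \<noteq> 0\<close> by (simp add: scaleC_scaleC scaleC_one)
    moreover have "complex_of_real (\<mu> e) / m = complex_of_real (sgn (\<mu> e))"
      by (simp add: m_def real_sgn_eq)
    ultimately show ?thesis by simp
  qed
qed

text \<open>If \<open>M\<close> contains a nonzero vector orthogonal to the null basis vectors,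
  \<open>V\<close> preserves its norm and the bound 1 is attained. Otherwise these finitely many
  vectors separate \<open>M\<close>, which is thus finite dimensional.\<close>

lemma diagonal_partial_isometry_norm_attaining:
  assumes V: "diagonal_op E V v" and fin: "finite {e \<in> E. v e = 0}"
    and v: "\<And>e. e \<in> E \<Longrightarrow> v e = 0 \<or> \<bar>v e\<bar> = 1"
  shows "absolutely_norm_attaining V"
  unfolding absolutely_norm_attaining_def
proof (intro conjI allI impI)
  show bV: "bounded_clinear V" using V by (rule diagonal_op_bounded)
  fix M :: "'a set" assume "cvec.subspace M \<and> closed M \<and> M \<noteq> {0}"
  then have M: "cvec.subspace M" "closed M" "M \<noteq> {0}" by blast+
  let ?Z = "{e \<in> E. v e = 0}"
  show "norm_attaining_on M V"
  proof (cases "\<exists>x\<in>M. x \<noteq> 0 \<and> (\<forall>e\<in>?Z. cinner x e = 0)")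
    case False
    then show ?thesis using norm_attaining_on_finite_dimensional[OF bV fin M] by blast
  next
    case True
    then obtain x where x: "x \<in> M" "x \<noteq> 0" "\<And>e. e \<in> ?Z \<Longrightarrow> cinner x e = 0" by blast
    define u where "u = complex_of_real (1 / norm x) *\<^sub>C x"
    have u: "u \<in> M" "norm u = 1"
      using x(1,2) by (simp_all add: u_def cvec.subspace_scale[OF M(1)] norm_divide)
    have "V (V u) = u"
    proof (rule eqI)
      fix e assume e: "e \<in> E"
      show "cinner (V (V u)) e = cinner u e"
      proof (cases "v e = 0")
        case True
        then have "cinner u e = 0" using x(3) e by (simp add: u_def cinner_scaleC_left)
        with True e show ?thesis by (simp add: diagonal_op_cinner[OF V])
      next
        case False
        then have "v e * v e = 1" using v[OF e] by (metis abs_mult_self_eq mult_1)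
        then have "complex_of_real (v e) * complex_of_real (v e) = 1"
          by (metis of_real_1 of_real_mult)
        then show ?thesis using e by (simp add: diagonal_op_cinner[OF V] flip: mult.assoc)
      qed
    qed
    then have "cinner (V u) (V u) = cinner u u" using diagonal_op_adjoint[OF V, of u "V u"] by simp
    then have Vu: "norm (V u) = 1" using u(2) by (simp add: norm_eq_1_iff_cinner)
    show ?thesis
    proof (rule norm_attaining_onI[OF u])
      fix y
      have "norm (V y) \<le> 1 * norm y"
        by (rule diagonal_op_norm_le[OF V]) (use v in force)+
      then show "norm (V y) \<le> norm (V u) * norm y" by (simp add: Vu)
    qed
  qed
qed

end

section \<open>Spectral structure\<close>

context orthonormal_basis
begin

lemma norm_eigenvalue:
  assumes T: "diagonal_op E T \<mu>" and e: "e \<in> E"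
  shows "norm (T e) = \<bar>\<mu> e\<bar>"
  by (simp add: diagonal_op_eigenvector[OF T e] orthonormal_norm[OF orthonormal e])

lemma finite_below_accumulation:
  assumes AN: "absolutely_norm_attaining T" and T: "diagonal_op E T \<mu>"
    and fin: "\<And>a. a < \<alpha> \<Longrightarrow> finite {e \<in> E. \<bar>\<mu> e\<bar> \<le> a}"
  shows "finite {e \<in> E. \<bar>\<mu> e\<bar> < \<alpha>}"
proof (rule ccontr)
  let ?L = "{e \<in> E. \<bar>\<mu> e\<bar> < \<alpha>}"
  assume inf: "infinite ?L"
  have "\<exists>f. \<forall>n. f n \<in> ?L \<and> \<bar>\<mu> (f n)\<bar> < \<bar>\<mu> (f (Suc n))\<bar>"
  proof (rule dependent_nat_choice)
    show "\<exists>x. x \<in> ?L" using infinite_imp_nonempty[OF inf] by blast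
    fix x n assume "x \<in> ?L"
    then have "finite {e \<in> E. \<bar>\<mu> e\<bar> \<le> \<bar>\<mu> x\<bar>}" by (intro fin) simp
    \<comment> \<open>Only finitely many moduli are at most the current one, so the infinite set
      still offers a strictly larger modulus below \<alpha>.\<close>
    then have "infinite (?L - {e \<in> E. \<bar>\<mu> e\<bar> \<le> \<bar>\<mu> x\<bar>})"
      using inf by (rule Diff_infinite_finite)
    then obtain y where "y \<in> ?L - {e \<in> E. \<bar>\<mu> e\<bar> \<le> \<bar>\<mu> x\<bar>}"
      using infinite_imp_nonempty by blast
    then show "\<exists>y. y \<in> ?L \<and> \<bar>\<mu> x\<bar> < \<bar>\<mu> y\<bar>" by auto
  qed
  then obtain f where f: "\<forall>n. f n \<in> ?L \<and> \<bar>\<mu> (f n)\<bar> < \<bar>\<mu> (f (Suc n))\<bar>" ..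
  then have fE: "f n \<in> E" and less: "\<bar>\<mu> (f n)\<bar> < \<bar>\<mu> (f (Suc n))\<bar>" for n by simp_all
  have "strict_mono (\<lambda>n. \<bar>\<mu> (f n)\<bar>)" using less by (simp add: strict_mono_Suc_iff)
  then have neq: "f m \<noteq> f n" if "m \<noteq> n" for m n :: nat
    using strict_mono_eq[OF \<open>strict_mono _\<close>, of m n] that by auto
  have ortho: "cinner (f m) (f n) = 0" if "m \<noteq> n" for m n
    using neq[OF that] by (simp add: orthonormal_cinner[OF orthonormal fE fE])
  show False
  proof (rule no_strictly_increasing_compression[OF AN, of f])
    show "cinner (f m) (f n) = 0" if "m \<noteq> n" for m n using that by (rule ortho)
    show "norm (f n) = 1" for n by (rule orthonormal_norm[OF orthonormal fE])
    show "cinner (T (f m)) (T (f n)) = 0" if "m \<noteq> n" for m n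
      using ortho[OF that]
      by (simp add: diagonal_op_eigenvector[OF T fE] cinner_scaleC_left cinner_scaleC_right)
    show "norm (T (f n)) < norm (T (f (Suc n)))" for n
      using less by (simp add: norm_eigenvalue[OF T fE])
  qed
qed

text \<open>
  If both sets below were infinite, rotating pairs of eigenvectors, one from each set, would
  realise a strictly increasing sequence of values in between.
\<close>

lemma eigenvalue_gap:
  assumes AN: "absolutely_norm_attaining T" and T: "diagonal_op E T \<mu>" and ab: "0 \<le> a" "a < b"
  shows "finite {e \<in> E. \<bar>\<mu> e\<bar> \<le> a} \<or> finite {e \<in> E. b \<le> \<bar>\<mu> e\<bar>}"
proof (rule ccontr)
  assume "\<not> ?thesis"
  then have inf: "infinite {e \<in> E. \<bar>\<mu> e\<bar> \<le> a}" "infinite {e \<in> E. b \<le> \<bar>\<mu> e\<bar>}" by simp_all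
  obtain e :: "nat \<Rightarrow> 'a" where "inj e" and er: "range e \<subseteq> {e \<in> E. \<bar>\<mu> e\<bar> \<le> a}"
    using infinite_countable_subset[OF inf(1)] by blast
  moreover obtain g :: "nat \<Rightarrow> 'a" where "inj g" and gr: "range g \<subseteq> {e \<in> E. b \<le> \<bar>\<mu> e\<bar>}"
    using infinite_countable_subset[OF inf(2)] by blast
  ultimately have inj: "inj e" "inj g" by simp_all
  have eE: "e n \<in> E" and ea: "\<bar>\<mu> (e n)\<bar> \<le> a" for n using er by auto
  have gE: "g n \<in> E" and gb: "b \<le> \<bar>\<mu> (g n)\<bar>" for n using gr by auto
  have eg: "e m \<noteq> g n" for m n using ea[of m] gb[of n] ab by auto
  \<comment> \<open>Different pairs span orthogonal planes, each invariant under \<open>T\<close>;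
    this one formula gives orthogonality of the \<open>f n\<close> and of their images as well as
    all the norms.\<close>
  have cross: "cinner (p *\<^sub>C e m + q *\<^sub>C g m) (r *\<^sub>C e n + s *\<^sub>C g n)
      = (if m = n then p * cnj r + q * cnj s else 0)" for p q r s m n
    using eg[of m n] eg[of n m] inj_eq[OF inj(1), of m n] inj_eq[OF inj(2), of m n]
    by (simp add: cinner_add_left cinner_add_right cinner_scaleC_left cinner_scaleC_right
        orthonormal_cinner[OF orthonormal] eE gE)
  \<comment> \<open>Prescribed values of \<open>(norm (T (f n)))\<^sup>2\<close>: they start at
    \<open>a\<^sup>2\<close> and increase strictly towards \<open>b\<^sup>2\<close>.\<close>
  define w where "w n = a\<^sup>2 + (b\<^sup>2 - a\<^sup>2) * (1 - 1 / real (Suc n))" for n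
  \<comment> \<open>The weight that makes the convex combination of
    \<open>(\<mu> (e n))\<^sup>2\<close> and \<open>(\<mu> (g n))\<^sup>2\<close> equal to
    \<open>w n\<close>. It lies in the unit interval because \<open>w n\<close> lies between
    them.\<close>
  define t where "t n = (w n - (\<mu> (e n))\<^sup>2) / ((\<mu> (g n))\<^sup>2 - (\<mu> (e n))\<^sup>2)" for n
  have sq: "a\<^sup>2 < b\<^sup>2" using ab by (intro power_strict_mono) auto
  have ea2: "(\<mu> (e n))\<^sup>2 \<le> a\<^sup>2" for n using abs_le_square_iff[of "\<mu> (e n)" a] ea[of n] ab(1) by simp
  have gb2: "b\<^sup>2 \<le> (\<mu> (g n))\<^sup>2" for n using abs_le_square_iff[of b "\<mu> (g n)"] gb[of n] ab by simp
  have w: "a\<^sup>2 \<le> w n" "w n \<le> b\<^sup>2" for n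
  proof -
    have "0 \<le> (b\<^sup>2 - a\<^sup>2) * (1 - 1 / real (Suc n))" using sq by (intro mult_nonneg_nonneg) auto
    then show "a\<^sup>2 \<le> w n" by (simp add: w_def)
    have "(b\<^sup>2 - a\<^sup>2) * (1 - 1 / real (Suc n)) \<le> (b\<^sup>2 - a\<^sup>2) * 1"
      using sq by (intro mult_left_mono) auto
    then show "w n \<le> b\<^sup>2" by (simp add: w_def)
  qed
  have w_less: "w n < w (Suc n)" for n
    unfolding w_def using sq by (intro add_strict_left_mono mult_strict_left_mono) (auto simp: field_simps)
  have pos: "0 < (\<mu> (g n))\<^sup>2 - (\<mu> (e n))\<^sup>2" for n using ea2[of n] gb2[of n] sq by linarith
  have t: "0 \<le> t n" "t n \<le> 1" for n
    using pos[of n] w[of n] ea2[of n] gb2[of n] by (simp_all add: t_def divide_le_eq)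
  have tw: "(1 - t n) * (\<mu> (e n))\<^sup>2 + t n * (\<mu> (g n))\<^sup>2 = w n" for n
  proof -
    have "t n * ((\<mu> (g n))\<^sup>2 - (\<mu> (e n))\<^sup>2) = w n - (\<mu> (e n))\<^sup>2" using pos[of n] by (simp add: t_def)
    then show ?thesis by (simp add: algebra_simps)
  qed
  \<comment> \<open>Cosine and sine of the rotation; their squares are the weights
    \<open>1 - t n\<close> and \<open>t n\<close>.\<close>
  define c where "c n = complex_of_real (sqrt (1 - t n))" for n
  define s where "s n = complex_of_real (sqrt (t n))" for n
  have cc: "c n * cnj (c n) = complex_of_real (1 - t n)" and ss: "s n * cnj (s n) = complex_of_real (t n)" for n
    using t[of n] by (simp_all add: c_def s_def flip: of_real_mult)
  define f where "f n = c n *\<^sub>C e n + s n *\<^sub>C g n" for n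
  have Tf: "T (f n) = (c n * complex_of_real (\<mu> (e n))) *\<^sub>C e n + (s n * complex_of_real (\<mu> (g n))) *\<^sub>C g n" for n
    by (simp add: f_def bounded_clinear_linear[OF diagonal_op_bounded[OF T]]
        diagonal_op_eigenvector[OF T eE] diagonal_op_eigenvector[OF T gE] scaleC_scaleC)
  have Tfw: "(norm (T (f n)))\<^sup>2 = w n" for n
  proof -
    have "complex_of_real ((norm (T (f n)))\<^sup>2) = cinner (T (f n)) (T (f n))" by (simp only: cinner_self)
    also have "\<dots> = (c n * cnj (c n)) * complex_of_real ((\<mu> (e n))\<^sup>2)
        + (s n * cnj (s n)) * complex_of_real ((\<mu> (g n))\<^sup>2)"
      unfolding Tf cross by (simp add: power2_eq_square mult_ac)
    also have "\<dots> = complex_of_real (w n)"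
      unfolding cc ss by (simp only: of_real_mult[symmetric] of_real_add[symmetric] tw)
    finally show ?thesis by (simp only: of_real_eq_iff)
  qed
  show False
  proof (rule no_strictly_increasing_compression[OF AN, of f])
    show "cinner (f m) (f n) = 0" if "m \<noteq> n" for m n using that by (simp add: f_def cross)
    show "norm (f n) = 1" for n
    proof -
      have "cinner (f n) (f n) = 1" unfolding f_def cross cc ss by (simp flip: of_real_add)
      then show ?thesis by (simp only: norm_eq_1_iff_cinner)
    qed
    show "cinner (T (f m)) (T (f n)) = 0" if "m \<noteq> n" for m n using that by (simp add: Tf cross)
    show "norm (T (f n)) < norm (T (f (Suc n)))" for n
      using w_less[of n] unfolding Tfw[symmetric] by (rule power2_less_imp_less) simp
  qed
qed

text \<open>For infinite \<open>E\<close>, \<alpha> is the supremum of the levels reached or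
  exceeded by infinitely many moduli. Above \<alpha>, finiteness is the definition. For
  \<open>a < \<alpha>\<close> some level \<open>b > a\<close> has infinitely many moduli at or above
  it, so \<open>eigenvalue_gap\<close> leaves finitely many at or below \<open>a\<close>, and
  \<open>finite_below_accumulation\<close> makes this uniform up to \<alpha>.\<close>

lemma essential_modulus_exists:
  assumes AN: "absolutely_norm_attaining T" and T: "diagonal_op E T \<mu>"
  obtains \<alpha> where "0 \<le> \<alpha>" "finite {e \<in> E. \<bar>\<mu> e\<bar> < \<alpha>}" "\<forall>a>\<alpha>. finite {e \<in> E. a \<le> \<bar>\<mu> e\<bar>}"
proof (cases "finite E")
  case True
  \<comment> \<open>In finite dimension no level is reached infinitely often and the supremum below
    would be over the empty set; 0 serves instead.\<close>
  then show ?thesis by (intro that[of 0]) simp_all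
next
  case False
  define S where "S = {a. 0 \<le> a \<and> infinite {e \<in> E. a \<le> \<bar>\<mu> e\<bar>}}"
  have "0 \<in> S" using False by (simp add: S_def)
  obtain B where B: "\<And>x. norm (T x) \<le> B * norm x"
    using bounded_clinear_bounded[OF diagonal_op_bounded[OF T]] by blast
  have \<mu>B: "\<bar>\<mu> e\<bar> \<le> B" if "e \<in> E" for e
    using B[of e] norm_eigenvalue[OF T that] orthonormal_norm[OF orthonormal that] by simp
  have bdd: "bdd_above S"
  proof (rule bdd_aboveI)
    fix a assume "a \<in> S"
    then have "{e \<in> E. a \<le> \<bar>\<mu> e\<bar>} \<noteq> {}" by (intro infinite_imp_nonempty) (simp add: S_def)
    then obtain e where "e \<in> E" "a \<le> \<bar>\<mu> e\<bar>" by blast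
    then show "a \<le> B" using \<mu>B[of e] by simp
  qed
  define \<alpha> where "\<alpha> = Sup S"
  have \<alpha>0: "0 \<le> \<alpha>" unfolding \<alpha>_def using \<open>0 \<in> S\<close> bdd by (rule cSup_upper)
  have above: "finite {e \<in> E. a \<le> \<bar>\<mu> e\<bar>}" if "\<alpha> < a" for a
  proof (rule ccontr)
    assume "infinite {e \<in> E. a \<le> \<bar>\<mu> e\<bar>}"
    then have "a \<in> S" using that \<alpha>0 by (simp add: S_def)
    then have "a \<le> \<alpha>" unfolding \<alpha>_def using bdd by (rule cSup_upper)
    with that show False by simp
  qed
  have "finite {e \<in> E. \<bar>\<mu> e\<bar> \<le> a}" if "a < \<alpha>" for a
  proof (cases "0 \<le> a")
    case True
    obtain b where "b \<in> S" "a < b"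
      using less_cSupD[of S a] \<open>a < \<alpha>\<close> \<open>0 \<in> S\<close> unfolding \<alpha>_def by auto
    then have "infinite {e \<in> E. b \<le> \<bar>\<mu> e\<bar>}" by (simp add: S_def)
    then show ?thesis using eigenvalue_gap[OF AN T True \<open>a < b\<close>] by simp
  next
    case False
    then have "{e \<in> E. \<bar>\<mu> e\<bar> \<le> a} = {}" by auto
    then show ?thesis by (simp only: finite.emptyI)
  qed
  then have "finite {e \<in> E. \<bar>\<mu> e\<bar> < \<alpha>}" by (rule finite_below_accumulation[OF AN T])
  with \<alpha>0 show ?thesis by (rule that) (intro allI impI above)
qed

end

theorem theorem3p3:
  fixes T V :: "'a :: chilbert_space \<Rightarrow> 'a"
  assumes "absolutely_norm_attaining T"
    and "selfadjoint_op T"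
    and "polar_decomposition T V"
  shows "\<exists>(\<alpha>::real) K F.
    \<alpha> \<ge> 0 \<and>
    compact_op K \<and> selfadjoint_op K \<and>
    finite_rank_op F \<and> selfadjoint_op F \<and>
    (T = (\<lambda>x. K x - F x + complex_of_real \<alpha> *\<^sub>C V x) \<and>
      K \<circ> F = (\<lambda>x. 0) \<and>
      op_le (F \<circ> F) (\<lambda>x. complex_of_real (\<alpha>\<^sup>2) *\<^sub>C x)) \<and>
    (\<not> compact_op T \<longrightarrow> absolutely_norm_attaining V) \<and>
    positive_op (\<lambda>x. K (K x) + complex_of_real (2 * \<alpha>) *\<^sub>C Re_op (V \<circ> K) x)"
proof -
  obtain E :: "'a set" and \<mu> where E: "orthonormal E"
    "\<And>x. (\<And>e. e \<in> E \<Longrightarrow> cinner x e = 0) \<Longrightarrow> x = 0"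
    and eig: "\<And>e. e \<in> E \<Longrightarrow> T e = complex_of_real (\<mu> e) *\<^sub>C e"
    using orthonormal_eigenbasis_exists[OF assms(1,2)] by metis
  interpret orthonormal_basis E
  proof (rule orthonormal_basis.intro)
    show "orthonormal E" by (rule E(1))
    show "x = 0" if "\<And>e. e \<in> E \<Longrightarrow> cinner x e = 0" for x using that by (rule E(2))
  qed
  have T: "diagonal_op E T \<mu>"
    using assms(2) eig by (intro diagonal_opI) (simp_all add: selfadjoint_op_def)
  have V: "diagonal_op E V (\<lambda>e. sgn (\<mu> e))"
    by (rule diagonal_polar_decomposition[OF T assms(3)])
  obtain \<alpha> where \<alpha>: "0 \<le> \<alpha>" and below: "finite {e \<in> E. \<bar>\<mu> e\<bar> < \<alpha>}"
    and above: "\<forall>a>\<alpha>. finite {e \<in> E. a \<le> \<bar>\<mu> e\<bar>}"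
    by (rule essential_modulus_exists[OF assms(1) T])
  \<comment> \<open>The signs are arranged so that
    \<open>k e - f e + \<alpha> * sgn (\<mu> e) = \<mu> e\<close> in every case, including
    \<open>\<mu> e = 0\<close>, where all three terms vanish.\<close>
  define f where "f e = (if \<bar>\<mu> e\<bar> < \<alpha> then sgn (\<mu> e) * (\<alpha> - \<bar>\<mu> e\<bar>) else 0)" for e
  define k where "k e = (if \<alpha> < \<bar>\<mu> e\<bar> then sgn (\<mu> e) * (\<bar>\<mu> e\<bar> - \<alpha>) else 0)" for e
  define F where "F = (\<lambda>x. \<Sum>g\<in>{e \<in> E. \<bar>\<mu> e\<bar> < \<alpha>}. complex_of_real (f g) *\<^sub>C cinner x g *\<^sub>C g)"
  \<comment> \<open>Defining \<open>K\<close> as the remainder gives boundedness and the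
    decomposition of \<open>T\<close> at once; its entries are then computed to be
    \<open>k\<close>.\<close>
  define K where "K = (\<lambda>x. T x + F x - complex_of_real \<alpha> *\<^sub>C V x)"
  have F: "diagonal_op E F f"
    by (rule diagonal_op_cong[OF _ diagonal_op_finite_sum[OF orthonormal below, of f, folded F_def]])
      (auto simp: f_def)
  have "diagonal_op E K (\<lambda>e. \<mu> e + f e - \<alpha> * sgn (\<mu> e))"
    unfolding K_def by (intro diagonal_op_diff diagonal_op_add diagonal_op_scaleC T F V)
  then have K: "diagonal_op E K k"
    by (rule diagonal_op_cong[rotated]) (auto simp: f_def k_def sgn_if)
  have "compact_op K"
  proof (rule diagonal_op_compact[OF K])
    fix \<epsilon> :: real assume "0 < \<epsilon>"
    \<comment> \<open>A nonzero \<open>k e\<close> has modulus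
      \<open>\<bar>\<mu> e\<bar> - \<alpha>\<close>, so the moduli can accumulate at \<alpha> while
      the entries of \<open>K\<close> tend to zero.\<close>
    have "{e \<in> E. \<epsilon> < \<bar>k e\<bar>} \<subseteq> {e \<in> E. \<alpha> + \<epsilon> \<le> \<bar>\<mu> e\<bar>}"
      using \<open>0 < \<epsilon>\<close> by (auto simp: k_def sgn_if split: if_splits)
    then show "finite {e \<in> E. \<epsilon> < \<bar>k e\<bar>}"
      by (rule finite_subset) (use above \<open>0 < \<epsilon>\<close> in simp)
  qed
  moreover have "finite_rank_op F"
  proof (rule diagonal_op_finite_rank[OF F])
    show "finite {e \<in> E. f e \<noteq> 0}" by (rule finite_subset[OF _ below]) (auto simp: f_def)
  qed
  moreover have "T = (\<lambda>x. K x - F x + complex_of_real \<alpha> *\<^sub>C V x)"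
    by (simp add: K_def)
  moreover have "K \<circ> F = (\<lambda>x. 0)"
    unfolding comp_def
    by (rule diagonal_op_eqI[OF diagonal_op_compose[OF K F] diagonal_op_zero]) (simp add: k_def f_def)
  moreover have "op_le (F \<circ> F) (\<lambda>x. complex_of_real (\<alpha>\<^sup>2) *\<^sub>C x)"
  proof -
    have FF: "diagonal_op E (F \<circ> F) (\<lambda>e. f e * f e)"
      unfolding comp_def by (rule diagonal_op_compose[OF F F])
    have I: "diagonal_op E (\<lambda>x. complex_of_real (\<alpha>\<^sup>2) *\<^sub>C x) (\<lambda>e. \<alpha>\<^sup>2 * 1)"
      by (intro diagonal_op_scaleC diagonal_op_ident)
    have "0 \<le> \<alpha>\<^sup>2 * 1 - f e * f e" for e
    proof -
      have "\<bar>f e\<bar> \<le> \<bar>\<alpha>\<bar>" using \<alpha> by (auto simp: f_def sgn_if)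
      then have "(f e)\<^sup>2 \<le> \<alpha>\<^sup>2" by (rule iffD1[OF abs_le_square_iff])
      then show ?thesis unfolding power2_eq_square[of "f e"] by simp
    qed
    then have "positive_op (\<lambda>x. complex_of_real (\<alpha>\<^sup>2) *\<^sub>C x - (F \<circ> F) x)"
      by (rule diagonal_op_positive[OF diagonal_op_diff[OF I FF]])
    then show ?thesis
      unfolding op_le_def using diagonal_op_selfadjoint[OF FF] diagonal_op_selfadjoint[OF I] by blast
  qed
  moreover have "absolutely_norm_attaining V" if "\<not> compact_op T"
  proof -
    \<comment> \<open>If \<alpha> were 0, only finitely many eigenvalues would exceed any positive
      bound in modulus, and \<open>T\<close> would be compact.\<close>
    have "0 < \<alpha>"
    proof (rule ccontr)
      assume "\<not> 0 < \<alpha>"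
      with \<alpha> have "\<alpha> = 0" by simp
      then have "finite {e \<in> E. \<epsilon> < \<bar>\<mu> e\<bar>}" if "0 < \<epsilon>" for \<epsilon>
        using that by (intro finite_subset[OF _ above[rule_format, of \<epsilon>]]) auto
      then show False using diagonal_op_compact[OF T] \<open>\<not> compact_op T\<close> by blast
    qed
    \<comment> \<open>Zero eigenvalues now lie strictly below \<alpha>, where there are only
      finitely many basis vectors.\<close>
    then have "finite {e \<in> E. sgn (\<mu> e) = 0}"
      by (intro finite_subset[OF _ below]) (auto simp: sgn_zero_iff)
    then show ?thesis
      by (rule diagonal_partial_isometry_norm_attaining[OF V]) (auto simp: sgn_if)
  qed
  moreover have "positive_op (\<lambda>x. K (K x) + complex_of_real (2 * \<alpha>) *\<^sub>C Re_op (V \<circ> K) x)"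
  proof -
    have VK: "diagonal_op E (\<lambda>x. V (K x)) (\<lambda>e. sgn (\<mu> e) * k e)"
      by (rule diagonal_op_compose[OF V K])
    then have "cadjoint (V \<circ> K) = V \<circ> K"
      using diagonal_op_selfadjoint[OF VK] by (simp add: selfadjoint_op_def comp_def)
    then have "Re_op (V \<circ> K) = (\<lambda>x. complex_of_real (1 / 2) *\<^sub>C (V (K x) + V (K x)))"
      by (simp add: Re_op_def)
    then have "diagonal_op E (\<lambda>x. K (K x) + complex_of_real (2 * \<alpha>) *\<^sub>C Re_op (V \<circ> K) x)
        (\<lambda>e. k e * k e + 2 * \<alpha> * (1 / 2 * (sgn (\<mu> e) * k e + sgn (\<mu> e) * k e)))"
      by (simp only:) (intro diagonal_op_add diagonal_op_scaleC diagonal_op_compose K V)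
    moreover have "0 \<le> k e * k e + 2 * \<alpha> * (1 / 2 * (sgn (\<mu> e) * k e + sgn (\<mu> e) * k e))" for e
    proof -
      \<comment> \<open>The sign of \<open>\<mu> e\<close> occurs twice, so the product is
        \<open>\<bar>\<mu> e\<bar> - \<alpha>\<close> when this is positive and 0 otherwise.\<close>
      have "0 \<le> sgn (\<mu> e) * k e" by (simp add: k_def sgn_if)
      with \<alpha> have "0 \<le> \<alpha> * (sgn (\<mu> e) * k e)" by (rule mult_nonneg_nonneg)
      then show ?thesis by (simp add: mult.left_commute mult.commute)
    qed
    ultimately show ?thesis by (rule diagonal_op_positive)
  qed
  ultimately show ?thesis
    using \<alpha> diagonal_op_selfadjoint[OF K] diagonal_op_selfadjoint[OF F]
    by (intro exI[of _ \<alpha>] exI[of _ K] exI[of _ F]) simp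
qed

end
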